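(* For all $n,m\in\mathbb{N}=\{1,2,\ldots\}$, the Lipschitz-free space $\mathcal{F}(\mathbb{R}^n\times\mathbb{Z}^m)$ is linearly isomorphic to $\mathcal{F}(\mathbb{R}^n)\oplus\mathcal{F}(\mathbb{Z}^{n+m})$.
   Context: $\mathbb{R}^n$ carries the metric of its Euclidean norm, and $\mathbb{R}^n\times\mathbb{Z}^m$ and $\mathbb{Z}^{n+m}$ are regarded as metric subspaces of $\mathbb{R}^{n+m}$ (any other norm yields bi-Lipschitz equivalent metrics and hence isomorphic Lipschitz-free spaces). For a metric space $M$ with a chosen base point $0\in M$, $\mathrm{Lip}_0(M)$ is the Banach space of Lipschitz functions $f:M\to\mathbb{R}$ with $f(0)=0$, normed by the best Lipschitz constant. The Lipschitz-free space is $\mathcal{F}(M)=\overline{\mathrm{span}}\{\delta(x):x\in M\}\subset \mathrm{Lip}_0(M)^*$, where $\delta(x)(f)=f(x)$. *)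

theory Defs
  imports "HOL-Analysis.Analysis"
begin

text \<open>
  The library gives \<^typ>\<open>int\<close> its discrete topology but no metric. We add the usual one. Then
  \<^typ>\<open>int ^ 'k\<close> and \<^typ>\<open>(real ^ 'n) \<times> (int ^ 'm)\<close> inherit the Euclidean distance from the library
  instances for \<^type>\<open>vec\<close> and \<^type>\<open>prod\<close>; see \<open>dist_real_int_eq\<close> and \<open>dist_int_vec_eq\<close> below.
\<close>

instantiation int :: metric_space
begin

definition dist_int :: "int \<Rightarrow> int \<Rightarrow> real"
  where "dist_int x y = \<bar>real_of_int x - real_of_int y\<bar>"

definition uniformity_int :: "(int \<times> int) filter"
  where "uniformity_int = (INF e\<in>{0 <..}. principal {(x, y). dist x y < e})"

instance
proof
  show "(uniformity :: (int \<times> int) filter) = (INF e\<in>{0 <..}. principal {(x, y). dist x y < e})"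
    by (rule uniformity_int_def)
next
  fix U :: "int set"
  have "\<forall>\<^sub>F (x', y) in uniformity. x' = x \<longrightarrow> y \<in> U" if "x \<in> U" for x
  proof -
    have "\<forall>\<^sub>F p in principal {(x, y). dist x y < (1::real)}. case p of (x', y) \<Rightarrow> x' = x \<longrightarrow> y \<in> U"
      using that by (auto simp: eventually_principal dist_int_def simp flip: of_int_diff of_int_abs)
    then show ?thesis
      unfolding uniformity_int_def
      by (rule eventually_INF1 [rotated]) simp
  qed
  then show "open U \<longleftrightarrow> (\<forall>x\<in>U. \<forall>\<^sub>F (x', y) in uniformity. x' = x \<longrightarrow> y \<in> U)"
    by (simp add: open_discrete)
next
  fix x y z :: int
  show "dist x y = 0 \<longleftrightarrow> x = y"
    by (simp add: dist_int_def)
  show "dist x y \<le> dist x z + dist y z"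
    by (simp add: dist_int_def)
qed

end

lemma dist_real_int_eq:
  fixes p q :: "(real ^ 'n) \<times> (int ^ 'm)"
  defines "emb \<equiv> \<lambda>p. \<chi> k. case k of Inl i \<Rightarrow> fst p $ i | Inr j \<Rightarrow> real_of_int (snd p $ j)"
  shows "dist p q = dist (emb p :: real ^ ('n + 'm)) (emb q)"
proof -
  have "(\<Sum>k\<in>UNIV. (dist (emb p $ k) (emb q $ k))\<^sup>2)
      = (\<Sum>i\<in>UNIV. (dist (fst p $ i) (fst q $ i))\<^sup>2) + (\<Sum>j\<in>UNIV. (dist (snd p $ j) (snd q $ j))\<^sup>2)"
    unfolding UNIV_Plus_UNIV [symmetric]
    by (subst sum.Plus) (simp_all add: emb_def dist_int_def dist_real_def)
  then show ?thesis
    by (simp add: dist_prod_def dist_vec_def L2_set_def sum_nonneg)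
qed

lemma dist_int_vec_eq:
  fixes x y :: "int ^ 'k"
  shows "dist x y = dist ((\<chi> i. real_of_int (x $ i)) :: real ^ 'k) (\<chi> i. real_of_int (y $ i))"
  by (simp add: dist_vec_def dist_int_def dist_real_def)


text \<open>
  Base points are \<^term>\<open>0\<close>; the class \<^class>\<open>zero\<close> is purely syntactic, so \<^typ>\<open>'a\<close> below is an
  arbitrary metric space with a distinguished point.
\<close>

typedef (overloaded) ('a :: "{metric_space, zero}") lip0 =
  "{f :: 'a \<Rightarrow> real. f 0 = 0 \<and> (\<exists>L. L-lipschitz_on UNIV f)}"
  morphisms apply_lip0 Lip0
  by (rule exI [of _ "\<lambda>_. 0"]) (auto intro: lipschitz_on_constant)

setup_lifting type_definition_lip0

definition lipschitz_const :: "('a :: metric_space \<Rightarrow> real) \<Rightarrow> real"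
  where "lipschitz_const f = Inf {L. L-lipschitz_on UNIV f}"

lemma bdd_below_lipschitz: "bdd_below {L. L-lipschitz_on UNIV f}"
  by (rule bdd_belowI [of _ 0]) (auto dest: lipschitz_on_nonneg)

lemma lipschitz_const_le: "L-lipschitz_on UNIV f \<Longrightarrow> lipschitz_const f \<le> L"
  unfolding lipschitz_const_def by (rule cInf_lower) (auto intro: bdd_below_lipschitz)

lemma lipschitz_on_lipschitz_const:
  assumes "L-lipschitz_on UNIV f"
  shows "(lipschitz_const f)-lipschitz_on UNIV f"
proof (rule lipschitz_onI)
  have ne: "{L. L-lipschitz_on UNIV f} \<noteq> {}"
    using assms by auto
  show "0 \<le> lipschitz_const f"
    unfolding lipschitz_const_def by (rule cInf_greatest [OF ne]) (auto dest: lipschitz_on_nonneg)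
  fix x y
  show "dist (f x) (f y) \<le> lipschitz_const f * dist x y"
  proof (cases "x = y")
    case False
    have "dist (f x) (f y) / dist x y \<le> lipschitz_const f"
      unfolding lipschitz_const_def
      by (rule cInf_greatest [OF ne]) (use False in \<open>auto simp: divide_le_eq dest: lipschitz_onD\<close>)
    then show ?thesis
      using False by (simp add: divide_le_eq)
  qed simp
qed

instantiation lip0 :: ("{metric_space, zero}") real_normed_vector
begin

lift_definition norm_lip0 :: "'a lip0 \<Rightarrow> real" is lipschitz_const .

lift_definition zero_lip0 :: "'a lip0" is "\<lambda>_. 0"
  by (auto intro: lipschitz_on_constant)

lift_definition plus_lip0 :: "'a lip0 \<Rightarrow> 'a lip0 \<Rightarrow> 'a lip0" is "\<lambda>f g x. f x + g x"
  by (auto intro: lipschitz_on_add)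

lift_definition minus_lip0 :: "'a lip0 \<Rightarrow> 'a lip0 \<Rightarrow> 'a lip0" is "\<lambda>f g x. f x - g x"
  by (auto intro: lipschitz_on_diff)

lift_definition uminus_lip0 :: "'a lip0 \<Rightarrow> 'a lip0" is "\<lambda>f x. - f x"
  by auto

lift_definition scaleR_lip0 :: "real \<Rightarrow> 'a lip0 \<Rightarrow> 'a lip0" is "\<lambda>r f x. r * f x"
  by (auto intro: lipschitz_on_cmult_real)

definition dist_lip0 :: "'a lip0 \<Rightarrow> 'a lip0 \<Rightarrow> real"
  where "dist_lip0 f g = norm (f - g)"

definition sgn_lip0 :: "'a lip0 \<Rightarrow> 'a lip0"
  where "sgn_lip0 f = inverse (norm f) *\<^sub>R f"

definition uniformity_lip0 :: "('a lip0 \<times> 'a lip0) filter"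
  where "uniformity_lip0 = (INF e\<in>{0 <..}. principal {(x, y). dist x y < e})"

definition open_lip0 :: "'a lip0 set \<Rightarrow> bool"
  where "open_lip0 S = (\<forall>x\<in>S. \<forall>\<^sub>F (x', y) in uniformity. x' = x \<longrightarrow> y \<in> S)"

instance
proof
  fix f g h :: "'a lip0" and a b :: real
  show "f + g + h = f + (g + h)" "f + g = g + f" "0 + f = f" "- f + f = 0" "f - g = f + - g"
    "a *\<^sub>R (f + g) = a *\<^sub>R f + a *\<^sub>R g" "(a + b) *\<^sub>R f = a *\<^sub>R f + b *\<^sub>R f"
    "a *\<^sub>R b *\<^sub>R f = (a * b) *\<^sub>R f" "1 *\<^sub>R f = f"
    by (transfer, simp add: algebra_simps)+
  show "dist f g = norm (f - g)" by (rule dist_lip0_def)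
  show "sgn f = inverse (norm f) *\<^sub>R f" by (rule sgn_lip0_def)
  show "(uniformity :: ('a lip0 \<times> 'a lip0) filter) = (INF e\<in>{0 <..}. principal {(x, y). dist x y < e})"
    by (rule uniformity_lip0_def)
  show "open U \<longleftrightarrow> (\<forall>x\<in>U. \<forall>\<^sub>F (x', y) in uniformity. x' = x \<longrightarrow> y \<in> U)" for U :: "'a lip0 set"
    by (rule open_lip0_def)
  show "norm f = 0 \<longleftrightarrow> f = 0"
  proof transfer
    fix f :: "'a \<Rightarrow> real"
    assume f: "f 0 = 0 \<and> (\<exists>L. L-lipschitz_on UNIV f)"
    then have *: "(lipschitz_const f)-lipschitz_on UNIV f"
      by (auto intro: lipschitz_on_lipschitz_const)
    show "lipschitz_const f = 0 \<longleftrightarrow> f = (\<lambda>_. 0)"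
    proof
      assume "lipschitz_const f = 0"
      then have "f x = 0" for x
        using lipschitz_onD [OF *, of x 0] f by simp
      then show "f = (\<lambda>_. 0)" by auto
    next
      assume "f = (\<lambda>_. 0)"
      then have "lipschitz_const f \<le> 0"
        by (auto intro: lipschitz_const_le lipschitz_on_constant)
      then show "lipschitz_const f = 0"
        using lipschitz_on_nonneg [OF *] by simp
    qed
  qed
  show "norm (f + g) \<le> norm f + norm g"
    by transfer (auto intro!: lipschitz_const_le lipschitz_on_add intro: lipschitz_on_lipschitz_const)
  have le: "norm (c *\<^sub>R k) \<le> \<bar>c\<bar> * norm k" for c and k :: "'a lip0"
    by transfer (auto intro!: lipschitz_const_le lipschitz_on_cmult_real intro: lipschitz_on_lipschitz_const)
  show "norm (a *\<^sub>R f) = \<bar>a\<bar> * norm f"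
  proof (cases "a = 0")
    case True
    have "norm (0 :: 'a lip0) = 0"
      using le [of 0 0] by transfer
        (auto intro!: antisym lipschitz_const_le lipschitz_on_constant
          lipschitz_on_nonneg [OF lipschitz_on_lipschitz_const])
    moreover have "a *\<^sub>R f = 0"
      using True by transfer simp
    ultimately show ?thesis
      using True by simp
  next
    case False
    have "inverse a *\<^sub>R a *\<^sub>R f = f"
      using False by transfer (simp add: mult.assoc [symmetric])
    then have "norm f \<le> \<bar>inverse a\<bar> * norm (a *\<^sub>R f)"
      using le [of "inverse a" "a *\<^sub>R f"] by simp
    then have "\<bar>a\<bar> * norm f \<le> norm (a *\<^sub>R f)"
      using False by (simp add: field_simps)
    with le [of a f] show ?thesis by simp
  qed
qed

end

lemma abs_apply_lip0_le: "\<bar>apply_lip0 f x\<bar> \<le> norm f * dist x 0"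
proof transfer
  fix f :: "'a \<Rightarrow> real" and x
  assume f: "f 0 = 0 \<and> (\<exists>L. L-lipschitz_on UNIV f)"
  then have "(lipschitz_const f)-lipschitz_on UNIV f"
    by (auto intro: lipschitz_on_lipschitz_const)
  from lipschitz_onD [OF this, of x 0] f show "\<bar>f x\<bar> \<le> lipschitz_const f * dist x 0"
    by simp
qed

lift_definition lip_delta :: "'a :: {metric_space, zero} \<Rightarrow> 'a lip0 \<Rightarrow>\<^sub>L real"
  is "\<lambda>x f. apply_lip0 f x"
proof (rule bounded_linear_intro)
  fix x :: 'a and f g :: "'a lip0" and r :: real
  show "apply_lip0 (f + g) x = apply_lip0 f x + apply_lip0 g x" by transfer simp
  show "apply_lip0 (r *\<^sub>R f) x = r *\<^sub>R apply_lip0 f x" by transfer simp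
  show "norm (apply_lip0 f x) \<le> norm f * dist x 0"
    using abs_apply_lip0_le [of f x] by simp
qed

lemma subspace_closure_normed:
  fixes S :: "'a :: real_normed_vector set"
  assumes "subspace S"
  shows "subspace (closure S)"
proof (rule subspaceI)
  show "0 \<in> closure S"
    using closure_subset subspace_0 [OF assms] by blast
  show "x + y \<in> closure S" if xy: "x \<in> closure S" "y \<in> closure S" for x y
  proof -
    obtain u v where "\<And>n. u n \<in> S" "u \<longlonglongrightarrow> x" "\<And>n. v n \<in> S" "v \<longlonglongrightarrow> y"
      using xy unfolding closure_sequential by blast
    then have "\<forall>n. u n + v n \<in> S" "(\<lambda>n. u n + v n) \<longlonglongrightarrow> x + y"
      by (auto intro: subspace_add [OF assms] tendsto_add)
    then show ?thesis
      unfolding closure_sequential by (intro exI [of _ "\<lambda>n. u n + v n"]) simp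
  qed
  show "c *\<^sub>R x \<in> closure S" if x: "x \<in> closure S" for c x
  proof -
    obtain u where "\<And>n. u n \<in> S" "u \<longlonglongrightarrow> x"
      using x unfolding closure_sequential by blast
    then have "\<forall>n. c *\<^sub>R u n \<in> S" "(\<lambda>n. c *\<^sub>R u n) \<longlonglongrightarrow> c *\<^sub>R x"
      by (auto intro: subspace_scale [OF assms] tendsto_scaleR)
    then show ?thesis
      unfolding closure_sequential by (intro exI [of _ "\<lambda>n. c *\<^sub>R u n"]) simp
  qed
qed

text \<open>
  The Lipschitz-free space as a Banach space of its own, with the norm of the dual of \<^typ>\<open>'a lip0\<close>.
  Direct sums of such spaces are taken as \<^type>\<open>prod\<close>, i.e. with the (equivalent) Euclidean sum norm.
\<close>

typedef (overloaded) ('a :: "{metric_space, zero}") lip_free =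
  "closure (span (range (lip_delta :: 'a \<Rightarrow> 'a lip0 \<Rightarrow>\<^sub>L real)))"
  morphisms functional_of Lip_free
  using closure_subset span_zero by blast

setup_lifting type_definition_lip_free

lemma subspace_lip_free:
  "subspace (closure (span (range (lip_delta :: 'a :: {metric_space, zero} \<Rightarrow> 'a lip0 \<Rightarrow>\<^sub>L real))))"
  by (intro subspace_closure_normed subspace_span)

instantiation lip_free :: ("{metric_space, zero}") real_normed_vector
begin

lift_definition norm_lip_free :: "'a lip_free \<Rightarrow> real" is norm .

lift_definition zero_lip_free :: "'a lip_free" is 0
  by (rule subspace_0 [OF subspace_lip_free])

lift_definition plus_lip_free :: "'a lip_free \<Rightarrow> 'a lip_free \<Rightarrow> 'a lip_free" is "(+)"
  by (rule subspace_add [OF subspace_lip_free])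

lift_definition minus_lip_free :: "'a lip_free \<Rightarrow> 'a lip_free \<Rightarrow> 'a lip_free" is "(-)"
  by (rule subspace_diff [OF subspace_lip_free])

lift_definition uminus_lip_free :: "'a lip_free \<Rightarrow> 'a lip_free" is uminus
  by (rule subspace_neg [OF subspace_lip_free])

lift_definition scaleR_lip_free :: "real \<Rightarrow> 'a lip_free \<Rightarrow> 'a lip_free" is scaleR
  by (rule subspace_scale [OF subspace_lip_free])

definition dist_lip_free :: "'a lip_free \<Rightarrow> 'a lip_free \<Rightarrow> real"
  where "dist_lip_free f g = norm (f - g)"

definition sgn_lip_free :: "'a lip_free \<Rightarrow> 'a lip_free"
  where "sgn_lip_free f = inverse (norm f) *\<^sub>R f"

definition uniformity_lip_free :: "('a lip_free \<times> 'a lip_free) filter"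
  where "uniformity_lip_free = (INF e\<in>{0 <..}. principal {(x, y). dist x y < e})"

definition open_lip_free :: "'a lip_free set \<Rightarrow> bool"
  where "open_lip_free S = (\<forall>x\<in>S. \<forall>\<^sub>F (x', y) in uniformity. x' = x \<longrightarrow> y \<in> S)"

instance
proof
  fix f g h :: "'a lip_free" and a b :: real
  show "f + g + h = f + (g + h)" "f + g = g + f" "0 + f = f" "- f + f = 0" "f - g = f + - g"
    "a *\<^sub>R (f + g) = a *\<^sub>R f + a *\<^sub>R g" "(a + b) *\<^sub>R f = a *\<^sub>R f + b *\<^sub>R f"
    "a *\<^sub>R b *\<^sub>R f = (a * b) *\<^sub>R f" "1 *\<^sub>R f = f"
    "norm f = 0 \<longleftrightarrow> f = 0" "norm (a *\<^sub>R f) = \<bar>a\<bar> * norm f"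
    by (transfer, simp add: algebra_simps)+
  show "norm (f + g) \<le> norm f + norm g"
    by transfer (rule norm_triangle_ineq)
  show "dist f g = norm (f - g)" by (rule dist_lip_free_def)
  show "sgn f = inverse (norm f) *\<^sub>R f" by (rule sgn_lip_free_def)
  show "(uniformity :: ('a lip_free \<times> 'a lip_free) filter) = (INF e\<in>{0 <..}. principal {(x, y). dist x y < e})"
    by (rule uniformity_lip_free_def)
  show "open U \<longleftrightarrow> (\<forall>x\<in>U. \<forall>\<^sub>F (x', y) in uniformity. x' = x \<longrightarrow> y \<in> U)" for U :: "'a lip_free set"
    by (rule open_lip_free_def)
qed

end

instance lip_free :: ("{metric_space, zero}") banach
proof
  fix X :: "nat \<Rightarrow> 'a lip_free"
  assume X: "Cauchy X"
  have d: "dist (functional_of f) (functional_of g) = dist f g" for f g :: "'a lip_free"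
    unfolding dist_norm by transfer simp
  have "Cauchy (\<lambda>n. functional_of (X n))"
    using X by (simp add: Cauchy_def d)
  then obtain l where l: "(\<lambda>n. functional_of (X n)) \<longlonglongrightarrow> l"
    using Cauchy_convergent_iff convergent_def by blast
  have "l \<in> closure (span (range lip_delta))"
    by (rule closed_sequentially [OF closed_closure functional_of l])
  then obtain m where "l = functional_of m"
    by (metis functional_of_cases)
  with l have "X \<longlonglongrightarrow> m"
    by (simp add: tendsto_iff d)
  then show "convergent X"
    by (auto simp: convergent_def)
qed

end

theory Submission
  imports Defs
begin

text \<open>
  Dually, one decomposes spaces of Lipschitz functions by operators \<open>f \<mapsto> (x \<mapsto> \<Sum> c\<^sub>i f(y\<^sub>i))\<close> with finite sums; such
  an operator is the adjoint of one between free spaces. Write \<open>A(I)\<close> for the functions on the lattice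
  \<open>\<int>\<^sup>I\<close>. Interpolating linearly in one real coordinate at a time splits the functions on
  \<open>\<real>\<^sup>U \<times> \<int>\<^sup>T\<close> into \<open>A(U \<union> T)\<close> and, for each nonempty \<open>S \<subseteq> U\<close>, the functions on \<open>\<real>\<^sup>S \<times> \<int>\<^sup>R\<close> with
  \<open>R = (U - S) \<union> T\<close> that vanish as soon as some \<open>S\<close>-coordinate is an integer. The latter are bounded families
  indexed by the countably many unit cells, so up to isomorphism they do not depend on \<open>R\<close>. Comparing \<open>T\<close>
  with \<open>\<emptyset>\<close>, the theorem reduces to \<open>A(U \<union> T) \<oplus> A(U) \<sim> A(U \<union> T)\<close>, that is, to \<open>A(I) \<oplus> A(I) \<sim> A(I)\<close>. This
  follows by reflections: if \<open>Y\<close> and \<open>E\<close> denote the functions on \<open>\<nat> \<times> \<int>\<^sup>K\<close> and \<open>\<nat>\<^sup>2 \<times> \<int>\<^sup>K\<close> that vanish on the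
  boundary, then \<open>A(K \<union> {i,j}) \<sim> A(K) \<oplus> Y\<^sup>2 \<oplus> E\<^sup>2\<close>; a shear identifies \<open>\<nat> \<times> \<int>\<close> with \<open>\<nat>\<^sup>2\<close>, which gives
  \<open>E \<sim> Y \<oplus> E\<^sup>2\<close> and makes \<open>Y \<oplus> E\<close> isomorphic to its square.
\<close>

section \<open>Isomorphisms with finite kernels\<close>

text \<open>These are the finite combinations of point evaluations, that is, the functionals in the
  span of the deltas, but defined on arbitrary functions.\<close>

inductive fin_comb :: "(('a \<Rightarrow> real) \<Rightarrow> real) \<Rightarrow> bool" where
  fin_comb_zero: "fin_comb (\<lambda>f. 0)"
| fin_comb_eval: "fin_comb (\<lambda>f. f x)"
| fin_comb_add: "fin_comb \<phi> \<Longrightarrow> fin_comb \<psi> \<Longrightarrow> fin_comb (\<lambda>f. \<phi> f + \<psi> f)"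
| fin_comb_cmult: "fin_comb \<phi> \<Longrightarrow> fin_comb (\<lambda>f. c * \<phi> f)"

lemma fin_comb_diff:
  assumes "fin_comb \<phi>" "fin_comb \<psi>"
  shows "fin_comb (\<lambda>f. \<phi> f - \<psi> f)"
  using fin_comb_add [OF assms(1) fin_comb_cmult [OF assms(2), of "-1"]] by simp

lemma fin_comb_sum:
  assumes "\<And>i. i \<in> I \<Longrightarrow> fin_comb (\<phi> i)"
  shows "fin_comb (\<lambda>f. \<Sum>i\<in>I. \<phi> i f)"
  using assms
  by (induction I rule: infinite_finite_induct) (auto intro: fin_comb_zero fin_comb_add)

lemma fin_comb_if:
  assumes "P \<Longrightarrow> fin_comb \<phi>" "\<not> P \<Longrightarrow> fin_comb \<psi>"
  shows "fin_comb (\<lambda>f. if P then \<phi> f else \<psi> f)"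
  using assms by (cases P) simp_all

lemma fin_comb_linear:
  assumes "fin_comb \<phi>"
  shows "\<phi> (\<lambda>x. a * f x + b * g x) = a * \<phi> f + b * \<phi> g"
  using assms by induction (auto simp: algebra_simps)

text \<open>The adjoint of such an operator sends point evaluations into the span of point
  evaluations, so no weak-star continuity has to be discussed. Linearity is implied, and acting on
  all functions lets operators compose freely.\<close>

definition finite_kernel :: "(('a \<Rightarrow> real) \<Rightarrow> 'b \<Rightarrow> real) \<Rightarrow> bool"
  where "finite_kernel S \<longleftrightarrow> (\<forall>x. fin_comb (\<lambda>f. S f x))"

lemma fin_comb_finite_kernel:
  assumes "fin_comb \<phi>" "finite_kernel T"
  shows "fin_comb (\<lambda>f. \<phi> (T f))"
  using assms(1)
proof induction
  case (fin_comb_eval x)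
  then show ?case using assms(2) by (simp add: finite_kernel_def)
qed (auto intro: fin_comb.intros)

lemma finite_kernel_comp:
  assumes "finite_kernel S" "finite_kernel T"
  shows "finite_kernel (\<lambda>f. S (T f))"
  unfolding finite_kernel_def
proof
  fix x
  have "fin_comb (\<lambda>f. S f x)"
    using assms(1) by (simp add: finite_kernel_def)
  from fin_comb_finite_kernel [OF this assms(2)] show "fin_comb (\<lambda>f. S (T f) x)" .
qed

lemma finite_kernel_compose: "finite_kernel (\<lambda>f. f \<circ> g)"
  by (auto simp: finite_kernel_def intro: fin_comb_eval)

lemma finite_kernel_case_sum:
  assumes "finite_kernel S" "finite_kernel T"
  shows "finite_kernel (\<lambda>f. case_sum (S f) (T f))"
  unfolding finite_kernel_def
proof
  show "fin_comb (\<lambda>f. case_sum (S f) (T f) x)" for x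
    using assms by (cases x) (simp_all add: finite_kernel_def)
qed

lemma finite_kernel_linear:
  assumes "finite_kernel S"
  shows "S (\<lambda>x. a * f x + b * g x) = (\<lambda>x. a * S f x + b * S g x)"
  using assms by (intro ext fin_comb_linear) (simp add: finite_kernel_def)

text \<open>
  A normed function space is given by a predicate \<open>V L f\<close>, meaning that \<open>f\<close> belongs to it with norm at
  most \<open>L\<close>.
\<close>

definition iso_by where
  "iso_by V W S S' C C' \<longleftrightarrow> finite_kernel S \<and> finite_kernel S' \<and> 0 \<le> C \<and> 0 \<le> C' \<and>
    (\<forall>L f. V L f \<longrightarrow> W (C * L) (S f) \<and> S' (S f) = f) \<and>
    (\<forall>L g. W L g \<longrightarrow> V (C' * L) (S' g) \<and> S (S' g) = g)"
  for C C' :: real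

lemma iso_byD:
  assumes "iso_by V W S S' C C'"
  shows "finite_kernel S" "finite_kernel S'" "0 \<le> C" "0 \<le> C'"
    and "\<And>L f. V L f \<Longrightarrow> W (C * L) (S f)" "\<And>L g. W L g \<Longrightarrow> V (C' * L) (S' g)"
    and "\<And>L f. V L f \<Longrightarrow> S' (S f) = f" "\<And>L g. W L g \<Longrightarrow> S (S' g) = g"
  using assms by (simp_all add: iso_by_def)

definition free_iso :: "(real \<Rightarrow> ('a \<Rightarrow> real) \<Rightarrow> bool) \<Rightarrow> (real \<Rightarrow> ('b \<Rightarrow> real) \<Rightarrow> bool) \<Rightarrow> bool" (infix "\<sim>\<^sub>F" 50)
  where "V \<sim>\<^sub>F W \<longleftrightarrow> (\<exists>S S' C C'. iso_by V W S S' C C')"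

lemma free_isoI:
  assumes "finite_kernel S" "finite_kernel S'" "0 \<le> C" "0 \<le> C'"
    and "\<And>L f. V L f \<Longrightarrow> W (C * L) (S f)" "\<And>L g. W L g \<Longrightarrow> V (C' * L) (S' g)"
    and "\<And>L f. V L f \<Longrightarrow> S' (S f) = f" "\<And>L g. W L g \<Longrightarrow> S (S' g) = g"
  shows "V \<sim>\<^sub>F W"
proof -
  have "iso_by V W S S' C C'"
    unfolding iso_by_def by (intro conjI allI impI; fact assms)
  then show ?thesis
    unfolding free_iso_def by blast
qed

lemma free_iso_refl: "V \<sim>\<^sub>F V"
  by (rule free_isoI [of "\<lambda>f. f" "\<lambda>f. f" 1 1]) (auto simp: finite_kernel_def intro: fin_comb_eval)

lemma free_iso_sym:
  assumes "V \<sim>\<^sub>F W"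
  shows "W \<sim>\<^sub>F V"
proof -
  obtain S S' C C' where "iso_by V W S S' C C'"
    using assms unfolding free_iso_def by blast
  then have "iso_by W V S' S C' C"
    by (simp add: iso_by_def)
  then show ?thesis
    unfolding free_iso_def by blast
qed

lemma free_iso_trans [trans]:
  assumes "U \<sim>\<^sub>F V" "V \<sim>\<^sub>F W"
  shows "U \<sim>\<^sub>F W"
proof -
  obtain S S' C C' where iso1: "iso_by U V S S' C C'"
    using assms(1) unfolding free_iso_def by blast
  note 1 = iso_byD [OF iso1]
  obtain T T' D D' where iso2: "iso_by V W T T' D D'"
    using assms(2) unfolding free_iso_def by blast
  note 2 = iso_byD [OF iso2]
  show ?thesis
  proof (rule free_isoI [of "\<lambda>f. T (S f)" "\<lambda>f. S' (T' f)" "D * C" "C' * D'"])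
    show "W (D * C * L) (T (S f))" if "U L f" for L f
      using 2(5) [OF 1(5) [OF that]] by (simp add: mult.assoc)
    show "U (C' * D' * L) (S' (T' f))" if "W L f" for L f
      using 1(6) [OF 2(6) [OF that]] by (simp add: mult.assoc)
    show "S' (T' (T (S f))) = f" if "U L f" for L f
      using 1(7) [OF that] 2(7) [OF 1(5) [OF that]] by simp
    show "T (S (S' (T' f))) = f" if "W L f" for L f
      using 2(8) [OF that] 1(8) [OF 2(6) [OF that]] by simp
    show "finite_kernel (\<lambda>f. T (S f))" "finite_kernel (\<lambda>f. S' (T' f))"
      by (rule finite_kernel_comp [OF 2(1) 1(1)] finite_kernel_comp [OF 1(2) 2(2)])+
  qed (use 1(3,4) 2(3,4) in simp_all)
qed

text \<open>The sum carries the maximum norm. The bounds \<open>a\<close> and \<open>b\<close> are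
  separate because arbitrary predicates \<open>V\<close> and \<open>W\<close> need not be monotone
  in the bound.\<close>

definition vsum :: "(real \<Rightarrow> ('a \<Rightarrow> real) \<Rightarrow> bool) \<Rightarrow> (real \<Rightarrow> ('b \<Rightarrow> real) \<Rightarrow> bool) \<Rightarrow> real \<Rightarrow> ('a + 'b \<Rightarrow> real) \<Rightarrow> bool"
    (infixr "\<oplus>\<^sub>F" 65)
  where "(V \<oplus>\<^sub>F W) L f \<longleftrightarrow>
    (\<exists>a b. 0 \<le> a \<and> a \<le> L \<and> 0 \<le> b \<and> b \<le> L \<and> V a (f \<circ> Inl) \<and> W b (f \<circ> Inr))"

lemma vsumI:
  assumes "V a (f \<circ> Inl)" "W b (f \<circ> Inr)" "0 \<le> a" "a \<le> L" "0 \<le> b" "b \<le> L"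
  shows "(V \<oplus>\<^sub>F W) L f"
  using assms unfolding vsum_def by blast

lemma vsumE:
  assumes "(V \<oplus>\<^sub>F W) L f"
  obtains a b where "0 \<le> a" "a \<le> L" "0 \<le> b" "b \<le> L" "V a (f \<circ> Inl)" "W b (f \<circ> Inr)"
  using assms unfolding vsum_def by blast

lemma case_sum_comp: "case_sum f g \<circ> Inl = f" "case_sum f g \<circ> Inr = g"
  by auto

lemma case_sum_eta: "case_sum (f \<circ> Inl) (f \<circ> Inr) = f"
  by (auto split: sum.split)

lemma vsum_cong:
  assumes "V \<sim>\<^sub>F V'" "W \<sim>\<^sub>F W'"
  shows "V \<oplus>\<^sub>F W \<sim>\<^sub>F V' \<oplus>\<^sub>F W'"
proof -
  obtain S S' C C' where iso1: "iso_by V V' S S' C C'"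
    using assms(1) unfolding free_iso_def by blast
  note 1 = iso_byD [OF iso1]
  obtain T T' D D' where iso2: "iso_by W W' T T' D D'"
    using assms(2) unfolding free_iso_def by blast
  note 2 = iso_byD [OF iso2]
  have le: "c * a \<le> max c e * L" "e * a \<le> max c e * L" if "0 \<le> a" "a \<le> L" "0 \<le> c" "0 \<le> e"
    for a L c e :: real
    using that by (auto intro!: mult_mono)
  show ?thesis
  proof (rule free_isoI [of "\<lambda>f. case_sum (S (f \<circ> Inl)) (T (f \<circ> Inr))"
        "\<lambda>f. case_sum (S' (f \<circ> Inl)) (T' (f \<circ> Inr))" "max C D" "max C' D'"])
    show "finite_kernel (\<lambda>f. case_sum (S (f \<circ> Inl)) (T (f \<circ> Inr)))"
      by (rule finite_kernel_case_sum [OF finite_kernel_comp [OF 1(1) finite_kernel_compose] finite_kernel_comp [OF 2(1) finite_kernel_compose]])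
    show "finite_kernel (\<lambda>f. case_sum (S' (f \<circ> Inl)) (T' (f \<circ> Inr)))"
      by (rule finite_kernel_case_sum [OF finite_kernel_comp [OF 1(2) finite_kernel_compose] finite_kernel_comp [OF 2(2) finite_kernel_compose]])
    show "(V' \<oplus>\<^sub>F W') (max C D * L) (case_sum (S (f \<circ> Inl)) (T (f \<circ> Inr)))"
      if f: "(V \<oplus>\<^sub>F W) L f" for L f
    proof -
      from f obtain a b where *: "0 \<le> a" "a \<le> L" "0 \<le> b" "b \<le> L" "V a (f \<circ> Inl)" "W b (f \<circ> Inr)"
        unfolding vsum_def by blast
      show ?thesis
        unfolding case_sum_comp vsum_def
        using * 1(3,5) 2(3,5) le by (intro exI [of _ "C * a"] exI [of _ "D * b"]) simp
    qed
    show "(V \<oplus>\<^sub>F W) (max C' D' * L) (case_sum (S' (f \<circ> Inl)) (T' (f \<circ> Inr)))"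
      if f: "(V' \<oplus>\<^sub>F W') L f" for L f
    proof -
      from f obtain a b where *: "0 \<le> a" "a \<le> L" "0 \<le> b" "b \<le> L" "V' a (f \<circ> Inl)" "W' b (f \<circ> Inr)"
        unfolding vsum_def by blast
      show ?thesis
        unfolding case_sum_comp vsum_def
        using * 1(4,6) 2(4,6) le by (intro exI [of _ "C' * a"] exI [of _ "D' * b"]) simp
    qed
    show "case_sum (S' (case_sum (S (f \<circ> Inl)) (T (f \<circ> Inr)) \<circ> Inl))
        (T' (case_sum (S (f \<circ> Inl)) (T (f \<circ> Inr)) \<circ> Inr)) = f" if "(V \<oplus>\<^sub>F W) L f" for L f
      using that by (auto simp: vsum_def case_sum_comp 1(7) 2(7) case_sum_eta)
    show "case_sum (S (case_sum (S' (f \<circ> Inl)) (T' (f \<circ> Inr)) \<circ> Inl))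
        (T (case_sum (S' (f \<circ> Inl)) (T' (f \<circ> Inr)) \<circ> Inr)) = f" if "(V' \<oplus>\<^sub>F W') L f" for L f
      using that by (auto simp: vsum_def case_sum_comp 1(8) 2(8) case_sum_eta)
  qed (use 1(3,4) 2(3,4) in simp_all)
qed

lemma vsum_commute: "V \<oplus>\<^sub>F W \<sim>\<^sub>F W \<oplus>\<^sub>F V"
proof (rule free_isoI [of "\<lambda>f. f \<circ> case_sum Inr Inl" "\<lambda>f. f \<circ> case_sum Inr Inl" 1 1])
  show "finite_kernel (\<lambda>f. f \<circ> case_sum Inr Inl)" "finite_kernel (\<lambda>f. f \<circ> case_sum Inr Inl)"
    by (rule finite_kernel_compose)+
  show "(W \<oplus>\<^sub>F V) (1 * L) (f \<circ> case_sum Inr Inl)" if "(V \<oplus>\<^sub>F W) L f" for L f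
    using that unfolding vsum_def comp_def by auto
  show "(V \<oplus>\<^sub>F W) (1 * L) (f \<circ> case_sum Inr Inl)" if "(W \<oplus>\<^sub>F V) L f" for L f
    using that unfolding vsum_def comp_def by auto
  show "f \<circ> case_sum Inr Inl \<circ> case_sum Inr Inl = f" for f :: "'x + 'y \<Rightarrow> real"
    by (auto split: sum.split)
  then show "f \<circ> case_sum Inr Inl \<circ> case_sum Inr Inl = f" for f :: "'y + 'x \<Rightarrow> real"
    by (auto split: sum.split)
qed simp_all

lemma vsum_assoc: "(U \<oplus>\<^sub>F V) \<oplus>\<^sub>F W \<sim>\<^sub>F U \<oplus>\<^sub>F (V \<oplus>\<^sub>F W)"
proof -
  let ?p = "case_sum (Inl \<circ> Inl) (case_sum (Inl \<circ> Inr) Inr)"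
  let ?q = "case_sum (case_sum Inl (Inr \<circ> Inl)) (Inr \<circ> Inr)"
  show ?thesis
  proof (rule free_isoI [of "\<lambda>f. f \<circ> ?p" "\<lambda>f. f \<circ> ?q" 1 1])
    show "finite_kernel (\<lambda>f. f \<circ> ?p)" "finite_kernel (\<lambda>f. f \<circ> ?q)"
      by (rule finite_kernel_compose)+
    show "(U \<oplus>\<^sub>F (V \<oplus>\<^sub>F W)) (1 * L) (f \<circ> ?p)" if f: "((U \<oplus>\<^sub>F V) \<oplus>\<^sub>F W) L f" for L f
    proof -
      obtain a b a' b' where "0 \<le> a" "a \<le> L" "0 \<le> b" "b \<le> L" "0 \<le> a'" "a' \<le> a" "0 \<le> b'" "b' \<le> a"
        "U a' (f \<circ> Inl \<circ> Inl)" "V b' (f \<circ> Inl \<circ> Inr)" "W b (f \<circ> Inr)"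
        using f unfolding vsum_def by blast
      then show ?thesis
        by (intro vsumI [of _ a' _ _ L] vsumI [of _ b' _ _ b]) (simp_all add: comp_def)
    qed
    show "((U \<oplus>\<^sub>F V) \<oplus>\<^sub>F W) (1 * L) (f \<circ> ?q)" if f: "(U \<oplus>\<^sub>F (V \<oplus>\<^sub>F W)) L f" for L f
    proof -
      obtain a b a' b' where "0 \<le> a" "a \<le> L" "0 \<le> b" "b \<le> L" "0 \<le> a'" "a' \<le> b" "0 \<le> b'" "b' \<le> b"
        "U a (f \<circ> Inl)" "V a' (f \<circ> Inr \<circ> Inl)" "W b' (f \<circ> Inr \<circ> Inr)"
        using f unfolding vsum_def by blast
      then show ?thesis
        by (intro vsumI [of _ L _ _ b'] vsumI [of _ a _ _ a']) (simp_all add: comp_def)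
    qed
    show "f \<circ> ?p \<circ> ?q = f" "g \<circ> ?q \<circ> ?p = g" for f :: "('x + 'y) + 'z \<Rightarrow> real" and g :: "'x + 'y + 'z \<Rightarrow> real"
      by (auto split: sum.split)
  qed simp_all
qed

lemma vsum_cong1: "V \<sim>\<^sub>F V' \<Longrightarrow> V \<oplus>\<^sub>F W \<sim>\<^sub>F V' \<oplus>\<^sub>F W"
  by (intro vsum_cong free_iso_refl)

lemma vsum_cong2: "W \<sim>\<^sub>F W' \<Longrightarrow> V \<oplus>\<^sub>F W \<sim>\<^sub>F V \<oplus>\<^sub>F W'"
  by (intro vsum_cong free_iso_refl)

lemma vsum_left_commute: "U \<oplus>\<^sub>F (V \<oplus>\<^sub>F W) \<sim>\<^sub>F V \<oplus>\<^sub>F (U \<oplus>\<^sub>F W)"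
  using free_iso_trans [OF free_iso_sym [OF vsum_assoc]
      free_iso_trans [OF vsum_cong1 [OF vsum_commute] vsum_assoc]] .

lemma vsum_interchange: "(A \<oplus>\<^sub>F B) \<oplus>\<^sub>F (C \<oplus>\<^sub>F D) \<sim>\<^sub>F (A \<oplus>\<^sub>F C) \<oplus>\<^sub>F (B \<oplus>\<^sub>F D)"
  using free_iso_trans [OF vsum_assoc
      free_iso_trans [OF vsum_cong2 [OF vsum_left_commute] free_iso_sym [OF vsum_assoc]]] .

text \<open>The point is that \<open>Y \<oplus> E\<close> is idempotent, and \<open>F \<sim> K \<oplus> (Y \<oplus> E)\<^sup>2\<close>.\<close>

lemma square_absorb:
  assumes "E \<sim>\<^sub>F Y \<oplus>\<^sub>F (E \<oplus>\<^sub>F E)" "K \<sim>\<^sub>F K \<oplus>\<^sub>F K"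
    and "F \<sim>\<^sub>F (K \<oplus>\<^sub>F (Y \<oplus>\<^sub>F Y)) \<oplus>\<^sub>F (E \<oplus>\<^sub>F E)"
  shows "F \<sim>\<^sub>F F \<oplus>\<^sub>F F"
proof -
  let ?w = "Y \<oplus>\<^sub>F E"
  have "?w \<oplus>\<^sub>F ?w \<sim>\<^sub>F Y \<oplus>\<^sub>F (E \<oplus>\<^sub>F (Y \<oplus>\<^sub>F E))"
    by (rule vsum_assoc)
  also have "\<dots> \<sim>\<^sub>F Y \<oplus>\<^sub>F (Y \<oplus>\<^sub>F (E \<oplus>\<^sub>F E))"
    by (rule vsum_cong2 [OF vsum_left_commute])
  also have "\<dots> \<sim>\<^sub>F ?w"
    by (rule vsum_cong2 [OF free_iso_sym [OF assms(1)]])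
  finally have w: "?w \<oplus>\<^sub>F ?w \<sim>\<^sub>F ?w" .
  note assms(3)
  also have "(K \<oplus>\<^sub>F (Y \<oplus>\<^sub>F Y)) \<oplus>\<^sub>F (E \<oplus>\<^sub>F E) \<sim>\<^sub>F K \<oplus>\<^sub>F ((Y \<oplus>\<^sub>F Y) \<oplus>\<^sub>F (E \<oplus>\<^sub>F E))"
    by (rule vsum_assoc)
  also have "\<dots> \<sim>\<^sub>F K \<oplus>\<^sub>F (?w \<oplus>\<^sub>F ?w)"
    by (rule vsum_cong2 [OF vsum_interchange])
  also have "\<dots> \<sim>\<^sub>F K \<oplus>\<^sub>F ?w"
    by (rule vsum_cong2 [OF w])
  finally have F: "F \<sim>\<^sub>F K \<oplus>\<^sub>F ?w" .
  note F
  also have "K \<oplus>\<^sub>F ?w \<sim>\<^sub>F (K \<oplus>\<^sub>F K) \<oplus>\<^sub>F (?w \<oplus>\<^sub>F ?w)"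
    by (rule vsum_cong [OF assms(2) free_iso_sym [OF w]])
  also have "\<dots> \<sim>\<^sub>F (K \<oplus>\<^sub>F ?w) \<oplus>\<^sub>F (K \<oplus>\<^sub>F ?w)"
    by (rule vsum_interchange)
  also have "\<dots> \<sim>\<^sub>F F \<oplus>\<^sub>F F"
    by (rule vsum_cong [OF free_iso_sym [OF F] free_iso_sym [OF F]])
  finally show ?thesis .
qed

section \<open>Lipschitz functions vanishing on a set\<close>

text \<open>Functions on \<open>M\<close> are normalised to be \<open>0\<close> outside \<open>M\<close>, so that equality on \<open>M\<close> is equality.\<close>

definition lipf :: "('a \<Rightarrow> 'a \<Rightarrow> real) \<Rightarrow> 'a set \<Rightarrow> 'a set \<Rightarrow> real \<Rightarrow> ('a \<Rightarrow> real) \<Rightarrow> bool"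
  where "lipf d M Z L f \<longleftrightarrow> 0 \<le> L \<and> (\<forall>x\<in>M. \<forall>y\<in>M. \<bar>f x - f y\<bar> \<le> L * d x y) \<and>
    (\<forall>x. x \<in> Z \<or> x \<notin> M \<longrightarrow> f x = 0)"

lemma lipf_nonneg: "lipf d M Z L f \<Longrightarrow> 0 \<le> L"
  by (simp add: lipf_def)

lemma lipf_le: "lipf d M Z L f \<Longrightarrow> x \<in> M \<Longrightarrow> y \<in> M \<Longrightarrow> \<bar>f x - f y\<bar> \<le> L * d x y"
  by (simp add: lipf_def)

lemma lipf_zero: "lipf d M Z L f \<Longrightarrow> x \<in> Z \<or> x \<notin> M \<Longrightarrow> f x = 0"
  unfolding lipf_def by blast

text \<open>Functions are pulled back: composition with \<open>h\<close> goes forward with constant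
  \<open>D\<close>, composition with \<open>g\<close> back with constant \<open>C\<close>.\<close>

lemma lipf_biLipschitz:
  assumes "\<And>x. x \<in> M \<Longrightarrow> g x \<in> N" "\<And>y. y \<in> N \<Longrightarrow> h y \<in> M"
    and "\<And>x. x \<in> M \<Longrightarrow> h (g x) = x" "\<And>y. y \<in> N \<Longrightarrow> g (h y) = y"
    and "\<And>x. x \<in> M \<Longrightarrow> x \<in> Y \<longleftrightarrow> g x \<in> Z"
    and "0 \<le> C" "\<And>x y. x \<in> M \<Longrightarrow> y \<in> M \<Longrightarrow> e (g x) (g y) \<le> C * d x y"
    and "0 \<le> D" "\<And>x y. x \<in> N \<Longrightarrow> y \<in> N \<Longrightarrow> d (h x) (h y) \<le> D * e x y"
  shows "lipf d M Y \<sim>\<^sub>F lipf e N Z"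
proof (rule free_isoI [of "\<lambda>f y. if y \<in> N then f (h y) else 0" "\<lambda>f x. if x \<in> M then f (g x) else 0" D C])
  show "finite_kernel (\<lambda>f y. if y \<in> N then f (h y) else 0)" "finite_kernel (\<lambda>f x. if x \<in> M then f (g x) else 0)"
    unfolding finite_kernel_def by (intro allI fin_comb_if fin_comb_eval fin_comb_zero)+
  show "lipf e N Z (D * L) (\<lambda>y. if y \<in> N then f (h y) else 0)" if f: "lipf d M Y L f" for L f
  proof -
    have "\<bar>f (h x) - f (h y)\<bar> \<le> D * L * e x y" if "x \<in> N" "y \<in> N" for x y
    proof -
      have "\<bar>f (h x) - f (h y)\<bar> \<le> L * d (h x) (h y)"
        using f assms(2) [OF that(1)] assms(2) [OF that(2)] by (simp add: lipf_def)
      also have "\<dots> \<le> L * (D * e x y)"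
        using f assms(9) [OF that] by (intro mult_left_mono) (simp_all add: lipf_def)
      finally show ?thesis by (simp add: mult_ac)
    qed
    moreover have "(if y \<in> N then f (h y) else 0) = 0" if "y \<in> Z \<or> y \<notin> N" for y
      using f that assms(2,4) assms(5) [of "h y"] by (auto simp: lipf_def)
    ultimately show ?thesis
      using f assms(8) by (simp add: lipf_def)
  qed
  show "lipf d M Y (C * L) (\<lambda>x. if x \<in> M then f (g x) else 0)" if f: "lipf e N Z L f" for L f
  proof -
    have "\<bar>f (g x) - f (g y)\<bar> \<le> C * L * d x y" if "x \<in> M" "y \<in> M" for x y
    proof -
      have "\<bar>f (g x) - f (g y)\<bar> \<le> L * e (g x) (g y)"
        using f assms(1) [OF that(1)] assms(1) [OF that(2)] by (simp add: lipf_def)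
      also have "\<dots> \<le> L * (C * d x y)"
        using f assms(7) [OF that] by (intro mult_left_mono) (simp_all add: lipf_def)
      finally show ?thesis by (simp add: mult_ac)
    qed
    moreover have "(if x \<in> M then f (g x) else 0) = 0" if "x \<in> Y \<or> x \<notin> M" for x
      using f that assms(5) [of x] by (auto simp: lipf_def)
    ultimately show ?thesis
      using f assms(6) by (simp add: lipf_def)
  qed
  show "(\<lambda>x. if x \<in> M then if g x \<in> N then f (h (g x)) else 0 else 0) = f" if "lipf d M Y L f" for L f
    using that assms(1,3) by (auto simp: lipf_def)
  show "(\<lambda>y. if y \<in> N then if h y \<in> M then f (g (h y)) else 0 else 0) = f" if "lipf e N Z L f" for L f
    using that assms(2,4) by (auto simp: lipf_def)
qed (fact assms)+

lemma lipf_cong: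
  assumes "Z \<inter> M = Z' \<inter> M"
  shows "lipf d M Z = lipf d M Z'"
proof -
  have "x \<in> Z \<or> x \<notin> M \<longleftrightarrow> x \<in> Z' \<or> x \<notin> M" for x
    using assms by blast
  then show ?thesis
    by (simp add: lipf_def fun_eq_iff)
qed

text \<open>A bounded linear extension operator \<open>E\<close> makes restriction to
  \<open>N\<close> split: \<open>f\<close> corresponds to its restriction together with
  \<open>f\<close> minus the extension of that restriction, which vanishes on
  \<open>N\<close>.\<close>

lemma lipf_split:
  assumes "N \<subseteq> M" "\<And>x y. 0 \<le> d x y" "finite_kernel E" "0 \<le> C"
    and "\<And>L g. lipf d N Z L g \<Longrightarrow> lipf d M Z (C * L) (E g)"
    and "\<And>L g x. lipf d N Z L g \<Longrightarrow> x \<in> N \<Longrightarrow> E g x = g x"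
  shows "lipf d M Z \<sim>\<^sub>F lipf d N Z \<oplus>\<^sub>F lipf d M (Z \<union> N)"
proof -
  define R where "R f = (\<lambda>x. if x \<in> N then f x else 0)" for f :: "'a \<Rightarrow> real"
  have R: "finite_kernel R"
    unfolding finite_kernel_def R_def by (intro allI fin_comb_if fin_comb_eval fin_comb_zero)
  have lipR: "lipf d N Z L (R f)" if "lipf d M Z L f" for L f
    using that assms(1) by (auto simp: lipf_def R_def)
  have R_add: "R (\<lambda>x. E g x + h x) = g" if "lipf d N Z L g" "lipf d M (Z \<union> N) L' h" for L L' g h
    using that assms(1) assms(6) [OF that(1)] by (auto simp: R_def lipf_def)
  have lip_add: "\<bar>(f x + g x) - (f y + g y)\<bar> \<le> (a + b) * d x y"
    if "lipf d M Y a f" "lipf d M Y' b g" "x \<in> M" "y \<in> M" for f g x y a b Y Y'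
  proof -
    have "\<bar>f x - f y\<bar> \<le> a * d x y" "\<bar>g x - g y\<bar> \<le> b * d x y"
      using that by (auto simp: lipf_def)
    then show ?thesis
      by (simp add: distrib_right)
  qed
  show ?thesis
  proof (rule free_isoI [of "\<lambda>f. case_sum (R f) (\<lambda>x. f x - E (R f) x)"
        "\<lambda>F x. E (F \<circ> Inl) x + F (Inr x)" "1 + C" "1 + C"])
    show "finite_kernel (\<lambda>f. case_sum (R f) (\<lambda>x. f x - E (R f) x))"
    proof (rule finite_kernel_case_sum [OF R])
      show "finite_kernel (\<lambda>f x. f x - E (R f) x)"
        using finite_kernel_comp [OF assms(3) R] unfolding finite_kernel_def
        by (intro allI fin_comb_diff fin_comb_eval) blast
    qed
    show "finite_kernel (\<lambda>F x. E (F \<circ> Inl) x + F (Inr x))"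
      using finite_kernel_comp [OF assms(3) finite_kernel_compose] unfolding finite_kernel_def
      by (intro allI fin_comb_add fin_comb_eval) blast
    show "(lipf d N Z \<oplus>\<^sub>F lipf d M (Z \<union> N)) ((1 + C) * L) (case_sum (R f) (\<lambda>x. f x - E (R f) x))"
      if f: "lipf d M Z L f" for L f
    proof (rule vsumI)
      have E: "lipf d M Z (C * L) (E (R f))"
        by (intro assms(5) lipR f)
      have L: "0 \<le> L" using f by (simp add: lipf_def)
      show "lipf d N Z L (case_sum (R f) (\<lambda>x. f x - E (R f) x) \<circ> Inl)"
        using lipR [OF f] by (simp add: case_sum_comp)
      have "\<bar>(f x - E (R f) x) - (f y - E (R f) y)\<bar> \<le> (1 + C) * L * d x y" if "x \<in> M" "y \<in> M" for x y
      proof -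
        have "\<bar>f x - f y\<bar> \<le> L * d x y" "\<bar>E (R f) x - E (R f) y\<bar> \<le> C * L * d x y"
          using f E that by (auto simp: lipf_def)
        then show ?thesis
          by (simp add: algebra_simps)
      qed
      moreover have "f x - E (R f) x = 0" if "x \<in> Z \<union> N \<or> x \<notin> M" for x
        using that f E assms(6) [OF lipR [OF f]] by (auto simp: lipf_def R_def)
      ultimately show "lipf d M (Z \<union> N) ((1 + C) * L) (case_sum (R f) (\<lambda>x. f x - E (R f) x) \<circ> Inr)"
        using L assms(4) by (simp add: lipf_def case_sum_comp)
      show "0 \<le> L" "L \<le> (1 + C) * L" "0 \<le> (1 + C) * L"
        using L assms(4) by (simp_all add: distrib_right)
    qed simp
    show "lipf d M Z ((1 + C) * L) (\<lambda>x. E (F \<circ> Inl) x + F (Inr x))"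
      if F: "(lipf d N Z \<oplus>\<^sub>F lipf d M (Z \<union> N)) L F" for L F
    proof -
      obtain a b where ab: "0 \<le> a" "a \<le> L" "0 \<le> b" "b \<le> L"
        "lipf d N Z a (F \<circ> Inl)" "lipf d M (Z \<union> N) b (F \<circ> Inr)"
        using F unfolding vsum_def by blast
      have E: "lipf d M Z (C * a) (E (F \<circ> Inl))"
        by (intro assms(5) ab)
      have "\<bar>(E (F \<circ> Inl) x + F (Inr x)) - (E (F \<circ> Inl) y + F (Inr y))\<bar> \<le> (1 + C) * L * d x y"
        if "x \<in> M" "y \<in> M" for x y
      proof -
        have "C * a + b \<le> (1 + C) * L"
          using mult_left_mono [OF ab(2) assms(4)] ab(4) by (simp add: distrib_right)
        from mult_right_mono [OF this assms(2) [of x y]] lip_add [OF E ab(6) that] show ?thesis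
          by simp
      qed
      then show ?thesis
        using E ab assms(4) by (auto simp: lipf_def)
    qed
    show "(\<lambda>x. E (case_sum (R f) (\<lambda>x. f x - E (R f) x) \<circ> Inl) x
        + case_sum (R f) (\<lambda>x. f x - E (R f) x) (Inr x)) = f" for f
      by (simp add: case_sum_comp)
    show "case_sum (R (\<lambda>x. E (F \<circ> Inl) x + F (Inr x)))
        (\<lambda>x. E (F \<circ> Inl) x + F (Inr x) - E (R (\<lambda>x. E (F \<circ> Inl) x + F (Inr x))) x) = F"
      if F: "(lipf d N Z \<oplus>\<^sub>F lipf d M (Z \<union> N)) L F" for L F
    proof -
      obtain a b where ab: "lipf d N Z a (F \<circ> Inl)" "lipf d M (Z \<union> N) b (F \<circ> Inr)"
        using F unfolding vsum_def by blast
      have eq: "R (\<lambda>x. E (F \<circ> Inl) x + F (Inr x)) = F \<circ> Inl"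
        using R_add [OF ab] by (simp add: comp_def)
      show ?thesis
        unfolding eq by (auto simp: fun_eq_iff split: sum.split)
    qed
  qed (use assms(4) in simp_all)
qed

section \<open>Splitting off one coordinate\<close>

text \<open>With the sum norm, estimates made in one coordinate at a time add up without loss. The
  Euclidean distance is exchanged for it in \<open>lipf_embed\<close>.\<close>

definition l1_dist :: "('k::finite \<Rightarrow> real) \<Rightarrow> ('k \<Rightarrow> real) \<Rightarrow> real"
  where "l1_dist x y = (\<Sum>k\<in>UNIV. \<bar>x k - y k\<bar>)"

lemma l1_dist_nonneg: "0 \<le> l1_dist x y"
  by (simp add: l1_dist_def sum_nonneg)

lemma l1_dist_split: "l1_dist x y = \<bar>x i - y i\<bar> + (\<Sum>k\<in>-{i}. \<bar>x k - y k\<bar>)"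
  by (simp add: l1_dist_def sum.remove [of UNIV i] Compl_eq_Diff_UNIV)

lemma l1_dist_split2:
  assumes "i \<noteq> j"
  shows "l1_dist x y = \<bar>x i - y i\<bar> + \<bar>x j - y j\<bar> + (\<Sum>k\<in>-{i,j}. \<bar>x k - y k\<bar>)"
proof -
  have *: "-{i,j} = -{i} - {j}" by auto
  show ?thesis
    using assms unfolding l1_dist_split [of x y i] * by (subst sum.remove [of "-{i}" j]) auto
qed

lemma l1_dist_upd: "l1_dist (x(i := a)) (y(i := b)) = \<bar>a - b\<bar> + (\<Sum>k\<in>-{i}. \<bar>x k - y k\<bar>)"
  unfolding l1_dist_split [of _ _ i] by (auto intro!: sum.cong)

lemma l1_dist_coord: "\<bar>x i - y i\<bar> \<le> l1_dist x y"
  by (simp add: l1_dist_split [of x y i] sum_nonneg)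

definition box_set :: "('k \<Rightarrow> real set) \<Rightarrow> ('k \<Rightarrow> real) set"
  where "box_set D = {x. \<forall>k. x k \<in> D k}"

text \<open>The origin is the base point and always belongs to the zero set.\<close>

definition walls :: "('k \<Rightarrow> real set) \<Rightarrow> ('k \<Rightarrow> real) set"
  where "walls D = insert (\<lambda>_. 0) {x. \<exists>k. x k \<in> D k}"

definition lip_box :: "('k::finite \<Rightarrow> real set) \<Rightarrow> ('k \<Rightarrow> real set) \<Rightarrow> real \<Rightarrow> (('k \<Rightarrow> real) \<Rightarrow> real) \<Rightarrow> bool"
  where "lip_box D W = lipf l1_dist (box_set D) (walls W)"

lemma mem_box_set_upd: "x \<in> box_set (D(i := A)) \<longleftrightarrow> x i \<in> A \<and> (\<forall>k. k \<noteq> i \<longrightarrow> x k \<in> D k)"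
  by (auto simp: box_set_def)

text \<open>The extension operator acts in coordinate \<open>i\<close> alone, averaging the values
  at \<open>p t\<close> and \<open>q t\<close> with weights \<open>1 - w t\<close> and
  \<open>w t\<close>. Weight \<open>w = 0\<close> gives composition with a retraction,
  \<open>w = frac\<close> gives linear interpolation. The one-dimensional estimate
  \<open>interp\<close> suffices, since moving the other coordinates keeps the weights
  fixed.\<close>

lemma lip_box_split:
  fixes p q w :: "real \<Rightarrow> real" and D W :: "'k::finite \<Rightarrow> real set"
  assumes "B \<subseteq> A" "0 \<in> B" "\<And>t. 0 \<le> w t" "\<And>t. w t \<le> 1"
    and "\<And>t. t \<in> A \<Longrightarrow> p t \<in> B \<and> q t \<in> B" "\<And>t. t \<in> B \<Longrightarrow> p t = t \<and> w t = 0"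
    and interp: "\<And>u L s t. 0 \<le> L \<Longrightarrow> (\<forall>a\<in>B. \<forall>b\<in>B. \<bar>u a - u b\<bar> \<le> L * \<bar>a - b\<bar>) \<Longrightarrow> s \<in> A \<Longrightarrow> t \<in> A \<Longrightarrow>
      \<bar>((1 - w s) * u (p s) + w s * u (q s)) - ((1 - w t) * u (p t) + w t * u (q t))\<bar> \<le> L * \<bar>s - t\<bar>"
  shows "lip_box (D(i := A)) (W(i := {})) \<sim>\<^sub>F
    lip_box (D(i := B)) (W(i := {})) \<oplus>\<^sub>F lip_box (D(i := A)) (W(i := B))"
proof -
  let ?M = "box_set (D(i := A))" and ?N = "box_set (D(i := B))" and ?Z = "walls (W(i := {}))"
  define E where "E g x = (if x \<in> ?M then (1 - w (x i)) * g (x(i := p (x i))) + w (x i) * g (x(i := q (x i))) else 0)"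
    for g :: "('k \<Rightarrow> real) \<Rightarrow> real" and x
  have w1: "0 \<le> 1 - w t" for t
    using assms(4) by simp
  have N: "?N \<subseteq> ?M"
    using assms(1) by (auto simp: mem_box_set_upd)
  have fE: "finite_kernel E"
    unfolding finite_kernel_def E_def
    by (intro allI fin_comb_if fin_comb_add fin_comb_cmult fin_comb_eval fin_comb_zero)
  have EN: "E g x = g x" if "x \<in> ?N" for g x
    using that assms(1) assms(6) [of "x i"] by (auto simp: E_def mem_box_set_upd)
  have lipE: "lipf l1_dist ?M ?Z (1 * L) (E g)" if g: "lipf l1_dist ?N ?Z L g" for L g
  proof -
    have L: "0 \<le> L" using g by (simp add: lipf_def)
    have gl: "\<bar>g x - g y\<bar> \<le> L * l1_dist x y" if "x \<in> ?N" "y \<in> ?N" for x y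
      using g that by (simp add: lipf_def)
    have inN: "x(i := a) \<in> ?N" if "x \<in> ?M" "a \<in> B" for x a
      using that by (auto simp: mem_box_set_upd)
    have "\<bar>E g x - E g y\<bar> \<le> L * l1_dist x y" if xy: "x \<in> ?M" "y \<in> ?M" for x y
    proof -
      let ?r = "\<Sum>k\<in>-{i}. \<bar>x k - y k\<bar>"
      \<comment> \<open>The way from \<open>x\<close> to \<open>y\<close> leads through
        \<open>?x\<close>: first only coordinate \<open>i\<close> changes, then all the
        others.\<close>
      let ?x = "x(i := y i)"
      have x': "?x \<in> ?M"
        using xy by (auto simp: mem_box_set_upd)
      have "\<forall>a\<in>B. \<forall>b\<in>B. \<bar>g (x(i := a)) - g (x(i := b))\<bar> \<le> L * \<bar>a - b\<bar>"
      proof (intro ballI)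
        fix a b assume "a \<in> B" "b \<in> B"
        from gl [OF inN [OF xy(1) this(1)] inN [OF xy(1) this(2)]]
        show "\<bar>g (x(i := a)) - g (x(i := b))\<bar> \<le> L * \<bar>a - b\<bar>"
          by (simp add: l1_dist_upd)
      qed
      from interp [OF L this, of "x i" "y i"] have 1: "\<bar>E g x - E g ?x\<bar> \<le> L * \<bar>x i - y i\<bar>"
        using xy x' by (auto simp: E_def mem_box_set_upd)
      have *: "\<bar>g (x(i := a)) - g (y(i := a))\<bar> \<le> L * ?r" if "a \<in> B" for a
        using gl [OF inN inN, OF xy(1) that xy(2) that] by (simp add: l1_dist_upd)
      have Ex: "E g ?x = (1 - w (y i)) * g (x(i := p (y i))) + w (y i) * g (x(i := q (y i)))"
        using x' by (simp add: E_def)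
      have Ey: "E g y = (1 - w (y i)) * g (y(i := p (y i))) + w (y i) * g (y(i := q (y i)))"
        using xy by (simp add: E_def)
      have "\<bar>E g ?x - E g y\<bar> \<le> (1 - w (y i)) * \<bar>g (x(i := p (y i))) - g (y(i := p (y i)))\<bar>
          + w (y i) * \<bar>g (x(i := q (y i))) - g (y(i := q (y i)))\<bar>"
      proof -
        have eq: "E g ?x - E g y = (1 - w (y i)) * (g (x(i := p (y i))) - g (y(i := p (y i))))
          + w (y i) * (g (x(i := q (y i))) - g (y(i := q (y i))))"
          unfolding Ex Ey by (simp only: algebra_simps)
        show ?thesis
          unfolding eq
          by (rule order_trans [OF abs_triangle_ineq])
            (simp only: abs_mult abs_of_nonneg [OF assms(3)] abs_of_nonneg [OF w1] order_refl)
      qed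
      also have "\<dots> \<le> (1 - w (y i)) * (L * ?r) + w (y i) * (L * ?r)"
        by (intro add_mono mult_left_mono * w1 assms(3)) (use assms(5) [of "y i"] xy(2) in \<open>simp_all add: mem_box_set_upd\<close>)
      also have "\<dots> = L * ?r"
        by (simp add: algebra_simps)
      finally have 2: "\<bar>E g ?x - E g y\<bar> \<le> L * ?r" .
      have "\<bar>E g x - E g y\<bar> \<le> L * \<bar>x i - y i\<bar> + L * ?r"
        using 1 2 by linarith
      then show ?thesis
        unfolding l1_dist_split [of x y i] distrib_left .
    qed
    moreover have "E g x = 0" if "x \<in> ?Z \<or> x \<notin> ?M" for x
    proof (cases "x \<in> ?M")
      case True
      with that have "x \<in> ?Z" by blast
      then consider "x = (\<lambda>_. 0)" | k where "k \<noteq> i" "x k \<in> W k"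
        by (auto simp: walls_def split: if_splits)
      then show ?thesis
      proof cases
        case 1
        \<comment> \<open>\<open>0 \<in> B\<close> puts the base point into \<open>?N\<close>, where
          \<open>E g\<close> agrees with \<open>g\<close>.\<close>
        then have "x \<in> ?N"
          using True assms(2) by (auto simp: mem_box_set_upd)
        then show ?thesis
          using EN g 1 by (auto simp: lipf_def walls_def)
      next
        case 2
        then have "x(i := t) \<in> ?Z" for t
          by (auto simp: walls_def)
        then have "g (x(i := t)) = 0" for t
          using g by (simp add: lipf_def)
        then show ?thesis
          by (simp add: E_def)
      qed
    qed (simp add: E_def)
    ultimately show ?thesis
      using L by (simp add: lipf_def)
  qed
  have "lipf l1_dist ?M ?Z \<sim>\<^sub>F lipf l1_dist ?N ?Z \<oplus>\<^sub>F lipf l1_dist ?M (?Z \<union> ?N)"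
    by (rule lipf_split [OF N l1_dist_nonneg fE zero_le_one]) (erule lipE, rule EN)
  \<comment> \<open>A point of \<open>?M\<close> lies in \<open>?N\<close> exactly when its
    coordinate \<open>i\<close> is in \<open>B\<close>, so vanishing on \<open>?N\<close> is a wall
    condition.\<close>
  moreover have "lipf l1_dist ?M (?Z \<union> ?N) = lipf l1_dist ?M (walls (W(i := B)))"
    by (rule lipf_cong) (auto simp: walls_def mem_box_set_upd split: if_splits)
  ultimately show ?thesis
    by (simp add: lip_box_def)
qed

text \<open>Functions that vanish for \<open>x\<^sub>i \<ge> 0\<close> live on the other half space and are reflected to this one.\<close>

lemma lip_box_reflect:
  "lip_box (D(i := \<int>)) (W(i := \<nat>)) \<sim>\<^sub>F lip_box (D(i := \<nat>)) (W(i := {0}))"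
  unfolding lip_box_def
proof -
  let ?M = "box_set (D(i := \<int>))" and ?N = "box_set (D(i := \<nat>))"
  let ?Y = "walls (W(i := \<nat>))" and ?Z = "walls (W(i := {0}))"
  define r where "r x = x(i := - x i)" for x :: "'a \<Rightarrow> real"
  have r_r: "r (r x) = x" for x
    by (simp add: r_def)
  have r_i: "r x i = - x i" for x
    by (simp add: r_def)
  have r_l1: "l1_dist (r x) (r y) = l1_dist x y" for x y
    unfolding r_def l1_dist_upd l1_dist_split [of x y i] by simp
  have rM: "x \<in> ?N \<Longrightarrow> r x \<in> ?M" for x
    by (auto simp: mem_box_set_upd r_def Nats_altdef2)
  have rN: "r x \<in> ?N" if "x \<in> ?M" "x i \<le> 0" for x
    using that by (auto simp: mem_box_set_upd r_def Nats_altdef2)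
  have rYZ: "r x \<in> ?Y \<longleftrightarrow> x \<in> ?Z" if "x \<in> ?N" for x
  proof -
    have "- x i \<in> \<nat> \<longleftrightarrow> x i = 0"
      using that by (auto simp: mem_box_set_upd Nats_altdef2)
    moreover have "r x = (\<lambda>_. 0) \<longleftrightarrow> x = (\<lambda>_. 0)"
      by (metis r_r r_i fun_upd_triv minus_zero r_def)
    ultimately show ?thesis
      by (auto simp: walls_def r_def)
  qed
  \<comment> \<open>Functions on the source vanish wherever coordinate \<open>i\<close> is
    nonnegative, so extension by zero recovers them from the other half.\<close>
  have YM: "x \<in> ?Y" if "x \<in> ?M" "0 \<le> x i" for x
    using that by (auto simp: walls_def mem_box_set_upd Nats_altdef2)
  show "lipf l1_dist ?M ?Y \<sim>\<^sub>F lipf l1_dist ?N ?Z"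
  proof (rule free_isoI [of "\<lambda>f x. if x \<in> ?N then f (r x) else 0"
        "\<lambda>g x. if x \<in> ?M \<and> x i \<le> 0 then g (r x) else 0" 1 1])
    show "finite_kernel (\<lambda>f x. if x \<in> ?N then f (r x) else 0)"
      "finite_kernel (\<lambda>g x. if x \<in> ?M \<and> x i \<le> 0 then g (r x) else 0)"
      unfolding finite_kernel_def by (intro allI fin_comb_if fin_comb_eval fin_comb_zero)+
    show "lipf l1_dist ?N ?Z (1 * L) (\<lambda>x. if x \<in> ?N then f (r x) else 0)"
      if f: "lipf l1_dist ?M ?Y L f" for L f
    proof -
      have "\<bar>f (r x) - f (r y)\<bar> \<le> L * l1_dist x y" if "x \<in> ?N" "y \<in> ?N" for x y
        using lipf_le [OF f rM [OF that(1)] rM [OF that(2)]] by (simp add: r_l1)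
      moreover have "f (r x) = 0" if "x \<in> ?N" "x \<in> ?Z" for x
        using lipf_zero [OF f] rYZ that by blast
      ultimately show ?thesis
        using f by (simp add: lipf_def)
    qed
    show "lipf l1_dist ?M ?Y (1 * L) (\<lambda>x. if x \<in> ?M \<and> x i \<le> 0 then g (r x) else 0)"
      if g: "lipf l1_dist ?N ?Z L g" for L g
    proof -
      have L: "0 \<le> L" using g by (simp add: lipf_def)
      \<comment> \<open>Across the wall: \<open>r x\<close> has distance
        \<open>\<bar>x i\<bar>\<close> from the wall point \<open>x(i := 0)\<close>, and any
        \<open>y\<close> with positive coordinate \<open>i\<close> is at least that far from
        \<open>x\<close>.\<close>
      have *: "\<bar>g (r x)\<bar> \<le> L * l1_dist x y" if "x \<in> ?M" "x i \<le> 0" "0 < y i" for x y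
      proof -
        have "x(i := 0) \<in> ?N" "x(i := 0) \<in> ?Z"
          using that by (auto simp: mem_box_set_upd walls_def)
        then have "\<bar>g (r x) - 0\<bar> \<le> L * l1_dist (r x) (x(i := 0))"
          using lipf_le [OF g rN [OF that(1,2)], of "x(i := 0)"] lipf_zero [OF g, of "x(i := 0)"] by simp
        also have "l1_dist (r x) (x(i := 0)) = \<bar>x i\<bar>"
          unfolding r_def l1_dist_upd by simp
        also have "L * \<bar>x i\<bar> \<le> L * l1_dist x y"
          using l1_dist_coord [of x i y] that L by (intro mult_left_mono) auto
        finally show ?thesis by simp
      qed
      have "\<bar>(if x \<in> ?M \<and> x i \<le> 0 then g (r x) else 0) - (if y \<in> ?M \<and> y i \<le> 0 then g (r y) else 0)\<bar>
          \<le> L * l1_dist x y" if xy: "x \<in> ?M" "y \<in> ?M" for x y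
      proof -
        have sym: "l1_dist y x = l1_dist x y"
          by (simp add: l1_dist_def abs_minus_commute)
        have "\<bar>g (r x) - g (r y)\<bar> \<le> L * l1_dist x y" if "x i \<le> 0" "y i \<le> 0"
          using lipf_le [OF g rN [OF xy(1) that(1)] rN [OF xy(2) that(2)]] by (simp add: r_l1)
        then show ?thesis
          using xy * [OF xy(1), of y] * [OF xy(2), of x] sym mult_nonneg_nonneg [OF L l1_dist_nonneg, of x y]
          by auto
      qed
      moreover have "g (r x) = 0" if "x \<in> ?M" "x i \<le> 0" "x \<in> ?Y" for x
      proof -
        have "r x \<in> ?Z"
          using rYZ [OF rN [OF that(1,2)]] that(3) by (simp add: r_r)
        then show ?thesis
          using g by (simp add: lipf_def)
      qed
      ultimately show ?thesis
        using L unfolding lipf_def by simp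
    qed
    show "(\<lambda>x. if x \<in> ?M \<and> x i \<le> 0 then if r x \<in> ?N then f (r (r x)) else 0 else 0) = f"
      if f: "lipf l1_dist ?M ?Y L f" for L f
    proof
      show "(if x \<in> ?M \<and> x i \<le> 0 then if r x \<in> ?N then f (r (r x)) else 0 else 0) = f x" for x
        using lipf_zero [OF f, of x] rN [of x] YM [of x] by (cases "x i \<le> 0") (auto simp: r_r)
    qed
    show "(\<lambda>x. if x \<in> ?N then if r x \<in> ?M \<and> r x i \<le> 0 then g (r (r x)) else 0 else 0) = g"
      if g: "lipf l1_dist ?N ?Z L g" for L g
    proof
      show "(if x \<in> ?N then if r x \<in> ?M \<and> r x i \<le> 0 then g (r (r x)) else 0 else 0) = g x" for x
      proof (cases "x \<in> ?N")
        case True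
        then have "0 \<le> x i"
          by (auto simp: mem_box_set_upd Nats_altdef2)
        then show ?thesis
          using True rM [OF True] by (simp add: r_r r_i)
      qed (use g in \<open>simp add: lipf_def\<close>)
    qed
  qed simp_all
qed

text \<open>
  The upper half plane is mapped onto the quadrant by \<open>(t,x) \<mapsto> (t+x,t)\<close> for \<open>x \<ge> 0\<close> and \<open>(t,x) \<mapsto> (t,t-x)\<close> for
  \<open>x \<le> 0\<close>; both pieces are unimodular, hence lattice points correspond to lattice points.
\<close>

lemma lip_box_shear:
  assumes "i \<noteq> j"
  shows "lip_box (D(i := \<nat>, j := \<int>)) (W(i := {0}, j := {})) \<sim>\<^sub>F
    lip_box (D(i := \<nat>, j := \<nat>)) (W(i := {0}, j := {0}))"
  unfolding lip_box_def
proof (rule lipf_biLipschitz [where g = "\<lambda>x. x(i := x i + max (x j) 0, j := x i + max (- x j) 0)"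
      and h = "\<lambda>y. y(i := min (y i) (y j), j := y i - y j)" and C = 2 and D = 2])
  let ?g = "\<lambda>x. x(i := x i + max (x j) 0, j := x i + max (- x j) 0) :: 'a \<Rightarrow> real"
  let ?h = "\<lambda>y. y(i := min (y i) (y j), j := y i - y j) :: 'a \<Rightarrow> real"
  let ?M = "box_set (D(i := \<nat>, j := \<int>))" and ?N = "box_set (D(i := \<nat>, j := \<nat>))"
  have ji: "j \<noteq> i" using assms by simp
  have M: "x \<in> ?M \<longleftrightarrow> x i \<in> \<nat> \<and> x j \<in> \<int> \<and> (\<forall>k. k \<noteq> i \<longrightarrow> k \<noteq> j \<longrightarrow> x k \<in> D k)" for x
    using assms by (auto simp: box_set_def)
  have N: "x \<in> ?N \<longleftrightarrow> x i \<in> \<nat> \<and> x j \<in> \<nat> \<and> (\<forall>k. k \<noteq> i \<longrightarrow> k \<noteq> j \<longrightarrow> x k \<in> D k)" for x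
    using assms by (auto simp: box_set_def)
  show "?g x \<in> ?N" if "x \<in> ?M" for x
    using that unfolding M N by (auto simp: assms ji Nats_altdef2 max_def)
  show "?h y \<in> ?M" if "y \<in> ?N" for y
    using that unfolding M N by (auto simp: assms ji Nats_altdef2 min_def)
  show "?h (?g x) = x" for x
    using assms by (auto simp: fun_eq_iff min_def max_def)
  show "?g (?h y) = y" for y
    using assms by (auto simp: fun_eq_iff min_def max_def)
  show "x \<in> walls (W(i := {0}, j := {})) \<longleftrightarrow> ?g x \<in> walls (W(i := {0}, j := {0}))" if "x \<in> ?M" for x
  proof -
    let ?P = "\<exists>k. k \<noteq> i \<and> k \<noteq> j \<and> x k \<in> W k"
    have xi: "0 \<le> x i"
      using that unfolding M by (simp add: Nats_altdef2)
    have "x \<in> walls (W(i := {0}, j := {})) \<longleftrightarrow> x i = 0 \<or> ?P"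
      using assms by (auto simp: walls_def split: if_splits)
    moreover have "?g x \<in> walls (W(i := {0}, j := {0})) \<longleftrightarrow> ?g x i = 0 \<or> ?g x j = 0 \<or> ?P"
      using assms by (auto simp: walls_def fun_eq_iff split: if_splits)
    \<comment> \<open>One of the two \<open>max\<close> terms is zero, so the smaller of the two new
      coordinates is \<open>x i\<close>.\<close>
    moreover have "?g x i = 0 \<or> ?g x j = 0 \<longleftrightarrow> x i = 0"
      using xi assms by (auto simp: max_def)
    ultimately show ?thesis
      by blast
  qed
  show "l1_dist (?g x) (?g y) \<le> 2 * l1_dist x y" for x y
  proof -
    let ?r = "\<Sum>k\<in>-{i,j}. \<bar>x k - y k\<bar>"
    have "(\<Sum>k\<in>-{i,j}. \<bar>?g x k - ?g y k\<bar>) = ?r"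
      by (intro sum.cong) auto
    moreover have "0 \<le> ?r"
      by (simp add: sum_nonneg)
    ultimately show ?thesis
      unfolding l1_dist_split2 [OF assms] by (auto simp: assms max_def abs_if)
  qed
  show "l1_dist (?h x) (?h y) \<le> 2 * l1_dist x y" for x y
  proof -
    let ?r = "\<Sum>k\<in>-{i,j}. \<bar>x k - y k\<bar>"
    have "(\<Sum>k\<in>-{i,j}. \<bar>?h x k - ?h y k\<bar>) = ?r"
      by (intro sum.cong) auto
    moreover have "0 \<le> ?r"
      by (simp add: sum_nonneg)
    ultimately show ?thesis
      unfolding l1_dist_split2 [OF assms] by (auto simp: assms min_def abs_if)
  qed
qed simp_all

text \<open>\<open>abs\<close> retracts \<open>\<int>\<close> onto \<open>\<nat>\<close>, and a
  constant map retracts \<open>\<nat>\<close> onto \<open>{0}\<close>. Each retraction leaves one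
  copy of the functions on a half line with a wall at \<open>0\<close>, the first copy after
  reflection.\<close>

lemma lip_box_int_split:
  "lip_box (D(i := \<int>)) (W(i := {})) \<sim>\<^sub>F lip_box (D(i := {0})) (W(i := {})) \<oplus>\<^sub>F
    (lip_box (D(i := \<nat>)) (W(i := {0})) \<oplus>\<^sub>F lip_box (D(i := \<nat>)) (W(i := {0})))"
proof -
  let ?Y = "lip_box (D(i := \<nat>)) (W(i := {0}))"
  have "lip_box (D(i := \<int>)) (W(i := {})) \<sim>\<^sub>F
      lip_box (D(i := \<nat>)) (W(i := {})) \<oplus>\<^sub>F lip_box (D(i := \<int>)) (W(i := \<nat>))"
  proof (rule lip_box_split [where p = abs and q = abs and w = "\<lambda>_. 0"])
    fix u :: "real \<Rightarrow> real" and L s t :: real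
    assume L: "0 \<le> L" and u: "\<forall>a\<in>\<nat>. \<forall>b\<in>\<nat>. \<bar>u a - u b\<bar> \<le> L * \<bar>a - b\<bar>" and "s \<in> \<int>" "t \<in> \<int>"
    then have "\<bar>u \<bar>s\<bar> - u \<bar>t\<bar>\<bar> \<le> L * \<bar>\<bar>s\<bar> - \<bar>t\<bar>\<bar>"
      by (simp add: Nats_altdef2)
    also have "\<dots> \<le> L * \<bar>s - t\<bar>"
      using L by (intro mult_left_mono) auto
    finally show "\<bar>((1 - 0) * u \<bar>s\<bar> + 0 * u \<bar>s\<bar>) - ((1 - 0) * u \<bar>t\<bar> + 0 * u \<bar>t\<bar>)\<bar> \<le> L * \<bar>s - t\<bar>"
      by simp
  qed (auto simp: Nats_altdef2)
  also have "\<dots> \<sim>\<^sub>F lip_box (D(i := \<nat>)) (W(i := {})) \<oplus>\<^sub>F ?Y"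
    by (rule vsum_cong2 [OF lip_box_reflect])
  also have "\<dots> \<sim>\<^sub>F (lip_box (D(i := {0})) (W(i := {})) \<oplus>\<^sub>F ?Y) \<oplus>\<^sub>F ?Y"
    by (rule vsum_cong1, rule lip_box_split [where p = "\<lambda>_. 0" and q = "\<lambda>_. 0" and w = "\<lambda>_. 0"]) auto
  also have "\<dots> \<sim>\<^sub>F lip_box (D(i := {0})) (W(i := {})) \<oplus>\<^sub>F (?Y \<oplus>\<^sub>F ?Y)"
    by (rule vsum_assoc)
  finally show ?thesis .
qed

text \<open>Within one cell the interpolant is affine with slope at most \<open>L\<close> in
  absolute value. Otherwise the path from the smaller to the larger argument is cut at the integer
  after the former and the floor of the latter; the lengths of the three pieces add up, so the
  constant stays \<open>L\<close>.\<close>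

lemma floor_interpolation_lipschitz:
  fixes u :: "real \<Rightarrow> real"
  assumes u: "\<forall>a\<in>\<int>. \<forall>b\<in>\<int>. \<bar>u a - u b\<bar> \<le> L * \<bar>a - b\<bar>"
  defines "v \<equiv> \<lambda>t. (1 - frac t) * u (of_int \<lfloor>t\<rfloor>) + frac t * u (of_int \<lfloor>t\<rfloor> + 1)"
  shows "\<bar>v s - v t\<bar> \<le> L * \<bar>s - t\<bar>"
proof -
  have v: "v t = u (of_int \<lfloor>t\<rfloor>) + frac t * (u (of_int \<lfloor>t\<rfloor> + 1) - u (of_int \<lfloor>t\<rfloor>))" for t
    by (simp add: v_def algebra_simps)
  \<comment> \<open>The interpolant expanded at the right end of its cell, for the piece from
    \<open>s\<close> up to the next integer.\<close>
  have v': "v t = u (of_int \<lfloor>t\<rfloor> + 1) - (1 - frac t) * (u (of_int \<lfloor>t\<rfloor> + 1) - u (of_int \<lfloor>t\<rfloor>))" for t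
    by (simp add: v_def algebra_simps)
  have step: "\<bar>u (of_int n + 1) - u (of_int n)\<bar> \<le> L" for n
    using bspec [OF bspec [OF u], of "of_int n + 1" "of_int n"] by simp
  have cstep: "\<bar>c * (u (of_int n + 1) - u (of_int n))\<bar> \<le> L * c" if "0 \<le> c" for c n
    using mult_left_mono [OF step that, of n] that by (simp add: abs_mult mult.commute)
  have le: "\<bar>v s - v t\<bar> \<le> L * (t - s)" if "s \<le> t" for s t
  proof (cases "\<lfloor>s\<rfloor> = \<lfloor>t\<rfloor>")
    case True
    have "v t - v s = (t - s) * (u (of_int \<lfloor>t\<rfloor> + 1) - u (of_int \<lfloor>t\<rfloor>))"
      unfolding v True by (simp add: frac_def True algebra_simps)
    then show ?thesis
      using cstep [of "t - s" "\<lfloor>t\<rfloor>"] that by (simp add: abs_minus_commute [of "v s"])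
  next
    case False
    have "\<lfloor>s\<rfloor> \<le> \<lfloor>t\<rfloor>"
      using that by (rule floor_mono)
    then have "\<lfloor>s\<rfloor> + 1 \<le> \<lfloor>t\<rfloor>"
      using False by linarith
    then have fl': "real_of_int \<lfloor>s\<rfloor> + 1 \<le> of_int \<lfloor>t\<rfloor>"
      by linarith
    have "\<bar>v s - u (of_int \<lfloor>s\<rfloor> + 1)\<bar> \<le> L * (1 - frac s)"
      using cstep [of "1 - frac s" "\<lfloor>s\<rfloor>"] frac_lt_1 [of s] by (simp add: v' [of s])
    moreover have "\<bar>u (of_int \<lfloor>s\<rfloor> + 1) - u (of_int \<lfloor>t\<rfloor>)\<bar> \<le> L * (of_int \<lfloor>t\<rfloor> - of_int \<lfloor>s\<rfloor> - 1)"
    proof -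
      have "\<bar>of_int \<lfloor>s\<rfloor> + 1 - of_int \<lfloor>t\<rfloor> :: real\<bar> = of_int \<lfloor>t\<rfloor> - of_int \<lfloor>s\<rfloor> - 1"
        using fl' by linarith
      then show ?thesis
        using bspec [OF bspec [OF u], of "of_int \<lfloor>s\<rfloor> + 1" "of_int \<lfloor>t\<rfloor>"] by simp
    qed
    moreover have "\<bar>v t - u (of_int \<lfloor>t\<rfloor>)\<bar> \<le> L * frac t"
      using cstep [of "frac t" "\<lfloor>t\<rfloor>"] by (simp add: v [of t])
    moreover have "L * (t - s) = L * (1 - frac s) + L * (of_int \<lfloor>t\<rfloor> - of_int \<lfloor>s\<rfloor> - 1) + L * frac t"
      by (simp add: frac_def algebra_simps)
    ultimately show ?thesis
      by linarith
  qed
  show ?thesis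
    using le [of s t] le [of t s] by (cases "s \<le> t") (simp_all add: abs_minus_commute)
qed

lemma lip_box_real_split:
  "lip_box (D(i := UNIV)) (W(i := {})) \<sim>\<^sub>F
    lip_box (D(i := \<int>)) (W(i := {})) \<oplus>\<^sub>F lip_box (D(i := UNIV)) (W(i := \<int>))"
proof (rule lip_box_split [where p = "\<lambda>t. of_int \<lfloor>t\<rfloor>" and q = "\<lambda>t. of_int \<lfloor>t\<rfloor> + 1" and w = frac])
  show "frac t \<le> 1" for t :: real
    using frac_lt_1 [of t] by simp
qed (auto intro: floor_interpolation_lipschitz elim: Ints_cases)

section \<open>Lattices are isomorphic to their squares\<close>

text \<open>Coordinates outside \<open>I\<close> are frozen at \<open>0\<close> rather than removed,
  so that lattices of all ranks share one index type and induction on \<open>I\<close> is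
  possible.\<close>

definition lattice_box :: "'k set \<Rightarrow> 'k \<Rightarrow> real set"
  where "lattice_box I k = (if k \<in> I then \<int> else {0})"

abbreviation lip_lattice :: "'k::finite set \<Rightarrow> real \<Rightarrow> (('k \<Rightarrow> real) \<Rightarrow> real) \<Rightarrow> bool"
  where "lip_lattice I \<equiv> lip_box (lattice_box I) (\<lambda>_. {})"

lemma lip_lattice_insert:
  assumes "i \<notin> I"
  shows "lip_lattice (insert i I) \<sim>\<^sub>F lip_lattice I \<oplus>\<^sub>F
    (lip_box ((lattice_box I)(i := \<nat>)) ((\<lambda>_. {})(i := {0})) \<oplus>\<^sub>F
     lip_box ((lattice_box I)(i := \<nat>)) ((\<lambda>_. {})(i := {0})))"
proof -
  have "lattice_box (insert i I) = (lattice_box I)(i := \<int>)" "(lattice_box I)(i := {0}) = lattice_box I"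
    using assms by (auto simp: lattice_box_def fun_eq_iff)
  moreover have "(\<lambda>_. {})(i := {}) = (\<lambda>_. {} :: real set)"
    by auto
  ultimately show ?thesis
    using lip_box_int_split [of "lattice_box I" i "\<lambda>_. {}"] by simp
qed

text \<open>The shear turns the quadrant into a half plane, and splitting its integer coordinate
  gives the first claim. For the second, \<open>i\<close> is split first; the part with
  \<open>i\<close> frozen splits again along \<open>j\<close>, and the two half planes are sheared
  to quadrants.\<close>

lemma lip_box_two_ints:
  fixes D W :: "'k::finite \<Rightarrow> real set"
  assumes "i \<noteq> j"
  defines "E \<equiv> lip_box (D(i := \<nat>, j := \<nat>)) (W(i := {0}, j := {0}))"
    and "Y \<equiv> lip_box (D(i := {0}, j := \<nat>)) (W(i := {}, j := {0}))"
    and "K \<equiv> lip_box (D(i := {0}, j := {0})) (W(i := {}, j := {}))"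
  shows "E \<sim>\<^sub>F Y \<oplus>\<^sub>F (E \<oplus>\<^sub>F E)"
    and "lip_box (D(i := \<int>, j := \<int>)) (W(i := {}, j := {})) \<sim>\<^sub>F (K \<oplus>\<^sub>F (Y \<oplus>\<^sub>F Y)) \<oplus>\<^sub>F (E \<oplus>\<^sub>F E)"
proof -
  have twist: "f(i := a, j := b) = f(j := b, i := a)" for f :: "'k \<Rightarrow> real set" and a b
    using assms(1) by (rule fun_upd_twist)
  have shear: "lip_box (D(i := \<nat>, j := \<int>)) (W(i := {0}, j := {})) \<sim>\<^sub>F E"
    unfolding E_def by (rule lip_box_shear [OF assms(1)])
  \<comment> \<open>The shear is used with \<open>i\<close> and \<open>j\<close> exchanged, so that
    the piece split off has \<open>i\<close> frozen and is the same \<open>Y\<close> as in the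
    second claim.\<close>
  have "E \<sim>\<^sub>F lip_box (D(j := \<nat>, i := \<int>)) (W(j := {0}, i := {}))"
    unfolding E_def twist by (rule free_iso_sym [OF lip_box_shear]) (use assms(1) in simp)
  also have "\<dots> \<sim>\<^sub>F Y \<oplus>\<^sub>F (E \<oplus>\<^sub>F E)"
    unfolding E_def Y_def twist by (rule lip_box_int_split)
  finally show "E \<sim>\<^sub>F Y \<oplus>\<^sub>F (E \<oplus>\<^sub>F E)" .
  have "lip_box (D(i := \<int>, j := \<int>)) (W(i := {}, j := {})) \<sim>\<^sub>F
      lip_box (D(i := {0}, j := \<int>)) (W(i := {}, j := {})) \<oplus>\<^sub>F
      (lip_box (D(i := \<nat>, j := \<int>)) (W(i := {0}, j := {})) \<oplus>\<^sub>F
       lip_box (D(i := \<nat>, j := \<int>)) (W(i := {0}, j := {})))"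
    unfolding twist by (rule lip_box_int_split)
  also have "\<dots> \<sim>\<^sub>F (K \<oplus>\<^sub>F (Y \<oplus>\<^sub>F Y)) \<oplus>\<^sub>F (E \<oplus>\<^sub>F E)"
    unfolding K_def Y_def by (intro vsum_cong lip_box_int_split shear)
  finally show "lip_box (D(i := \<int>, j := \<int>)) (W(i := {}, j := {})) \<sim>\<^sub>F (K \<oplus>\<^sub>F (Y \<oplus>\<^sub>F Y)) \<oplus>\<^sub>F (E \<oplus>\<^sub>F E)" .
qed

section \<open>The lattice of rank one and bounded sequences\<close>

definition bounded_fun :: "real \<Rightarrow> ('a \<Rightarrow> real) \<Rightarrow> bool"
  where "bounded_fun L f \<longleftrightarrow> 0 \<le> L \<and> (\<forall>n. \<bar>f n\<bar> \<le> L)"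

text \<open>Even and odd integers carry the two summands. This serves rank one, where there is no
  second coordinate to shear.\<close>

lemma bounded_fun_square:
  "(bounded_fun :: real \<Rightarrow> (int \<Rightarrow> real) \<Rightarrow> bool) \<sim>\<^sub>F
    (bounded_fun :: real \<Rightarrow> (int \<Rightarrow> real) \<Rightarrow> bool) \<oplus>\<^sub>F (bounded_fun :: real \<Rightarrow> (int \<Rightarrow> real) \<Rightarrow> bool)"
proof -
  define p :: "int + int \<Rightarrow> int" where "p = case_sum (\<lambda>n. 2 * n) (\<lambda>n. 2 * n + 1)"
  define q :: "int \<Rightarrow> int + int" where "q n = (if even n then Inl (n div 2) else Inr (n div 2))" for n
  have qp: "q (p z) = z" for z
    by (cases z) (simp_all add: p_def q_def)
  have pq: "p (q n) = n" for n
    by (cases "even n") (simp_all add: p_def q_def)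
  show ?thesis
  proof (rule free_isoI [of "\<lambda>f. f \<circ> p" "\<lambda>f. f \<circ> q" 1 1])
    show "finite_kernel (\<lambda>f. f \<circ> p)" "finite_kernel (\<lambda>f. f \<circ> q)"
      by (rule finite_kernel_compose)+
    show "(bounded_fun \<oplus>\<^sub>F bounded_fun) (1 * L) (f \<circ> p)" if "bounded_fun L f" for L and f :: "int \<Rightarrow> real"
      using that by (intro vsumI [of _ L _ _ L]) (simp_all add: bounded_fun_def)
    show "bounded_fun (1 * L) (g \<circ> q)" if h: "(bounded_fun \<oplus>\<^sub>F bounded_fun) L g" for L and g :: "int + int \<Rightarrow> real"
    proof -
      obtain a b where ab: "0 \<le> a" "a \<le> L" "0 \<le> b" "b \<le> L"
        and g: "bounded_fun a (g \<circ> Inl)" "bounded_fun b (g \<circ> Inr)"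
        using h by (rule vsumE)
      have "\<bar>g z\<bar> \<le> L" for z
      proof (cases z)
        case (Inl n)
        have "\<bar>g (Inl n)\<bar> \<le> a"
          using g(1) by (simp add: bounded_fun_def)
        with ab Inl show ?thesis by simp
      next
        case (Inr n)
        have "\<bar>g (Inr n)\<bar> \<le> b"
          using g(2) by (simp add: bounded_fun_def)
        with ab Inr show ?thesis by simp
      qed
      then show ?thesis
        using ab by (simp add: bounded_fun_def)
    qed
    show "f \<circ> p \<circ> q = f" for f :: "int \<Rightarrow> real"
      by (rule ext) (simp add: pq)
    show "g \<circ> q \<circ> p = g" for g :: "int + int \<Rightarrow> real"
      by (rule ext) (simp add: qp)
  qed simp_all
qed

text \<open>Inverse of the difference operator; one of the two sums is always empty.\<close>

definition int_sum :: "(int \<Rightarrow> real) \<Rightarrow> int \<Rightarrow> real"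
  where "int_sum g n = (\<Sum>k\<in>{0..<n}. g k) - (\<Sum>k\<in>{n..<0}. g k)"

lemma int_sum_0: "int_sum g 0 = 0"
  by (simp add: int_sum_def)

lemma int_sum_Suc: "int_sum g (n + 1) = int_sum g n + g n"
proof (cases "0 \<le> n")
  case True
  then have "{0..<n + 1} = insert n {0..<n}" "{n + 1..<0} = {}" "{n..<0} = {}"
    by auto
  then show ?thesis
    by (simp add: int_sum_def)
next
  case False
  then have "{n..<0} = insert n {n + 1..<0}" "{0..<n + 1} = {}" "{0..<n} = {}"
    by auto
  then show ?thesis
    by (simp add: int_sum_def)
qed

lemma int_sum_unique:
  assumes "f 0 = 0"
  shows "int_sum (\<lambda>n. f (n + 1) - f n) n = f n"
proof (induction n rule: int_induct [of _ 0])
  case base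
  then show ?case using assms by (simp add: int_sum_0)
next
  case (step1 n)
  then show ?case by (simp add: int_sum_Suc)
next
  case (step2 n)
  then show ?case using int_sum_Suc [of "\<lambda>n. f (n + 1) - f n" "n - 1"] by simp
qed

lemma int_sum_lipschitz:
  assumes "\<And>n. \<bar>g n\<bar> \<le> L"
  shows "\<bar>int_sum g m - int_sum g n\<bar> \<le> L * \<bar>real_of_int m - real_of_int n\<bar>"
proof -
  have le: "\<bar>int_sum g m - int_sum g n\<bar> \<le> L * (of_int m - of_int n)" if "n \<le> m" for m n
    using that
  proof (induction m rule: int_ge_induct)
    case (step m)
    then have "\<bar>int_sum g (m + 1) - int_sum g n\<bar> \<le> L * (of_int m - of_int n) + L"
      using assms [of m] unfolding int_sum_Suc by linarith
    then show ?case
      by (simp add: algebra_simps)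
  qed simp
  show ?thesis
    using le [of n m] le [of m n] by (cases "n \<le> m") (simp_all add: abs_minus_commute)
qed

text \<open>The difference operator turns Lipschitz functions on \<open>\<int>\<close> vanishing at
  \<open>0\<close> into bounded functions. Its inverse \<open>int_sum\<close> has a finite kernel
  because each value is a finite sum.\<close>

lemma lip_lattice_singleton:
  "lip_lattice {i :: 'k::finite} \<sim>\<^sub>F (bounded_fun :: real \<Rightarrow> (int \<Rightarrow> real) \<Rightarrow> bool)"
proof -
  define e where "e n = (\<lambda>_. 0 :: real)(i := of_int n)" for n :: int
  let ?M = "box_set (lattice_box {i})" and ?Z = "walls (\<lambda>_ :: 'k. {})"
  have M: "x \<in> ?M \<longleftrightarrow> x = e \<lfloor>x i\<rfloor>" for x
  proof -
    have "x i \<in> \<int> \<longleftrightarrow> x i = of_int \<lfloor>x i\<rfloor>"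
      by (metis Ints_of_int floor_of_int Ints_cases)
    then show ?thesis
      unfolding box_set_def lattice_box_def e_def fun_eq_iff mem_Collect_eq
      by (metis fun_upd_apply insertCI singletonD)
  qed
  have eM: "e n \<in> ?M" for n
    by (auto simp: box_set_def lattice_box_def e_def)
  have e_i: "\<lfloor>e n i\<rfloor> = n" for n
    by (simp add: e_def)
  have Z: "?Z = {e 0}"
    by (auto simp: walls_def e_def)
  have l1: "l1_dist (e m) (e n) = \<bar>of_int m - of_int n\<bar>" for m n
    unfolding e_def l1_dist_upd by simp
  show ?thesis
    unfolding lip_box_def
  proof (rule free_isoI [of "\<lambda>f n. f (e (n + 1)) - f (e n)"
        "\<lambda>g x. if x \<in> ?M then int_sum g \<lfloor>x i\<rfloor> else 0" 1 1])
    show "finite_kernel (\<lambda>f n. f (e (n + 1)) - f (e n))"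
      unfolding finite_kernel_def by (intro allI fin_comb_diff fin_comb_eval)
    show "finite_kernel (\<lambda>g x. if x \<in> ?M then int_sum g \<lfloor>x i\<rfloor> else 0)"
      unfolding finite_kernel_def int_sum_def
      by (intro allI fin_comb_if fin_comb_diff fin_comb_sum fin_comb_eval fin_comb_zero)
    show "bounded_fun (1 * L) (\<lambda>n. f (e (n + 1)) - f (e n))" if f: "lipf l1_dist ?M ?Z L f" for L f
    proof -
      have "\<bar>f (e (n + 1)) - f (e n)\<bar> \<le> L" for n
        using lipf_le [OF f eM eM, of "n + 1" n] unfolding l1 by simp
      then show ?thesis
        using lipf_nonneg [OF f] by (simp add: bounded_fun_def)
    qed
    show "lipf l1_dist ?M ?Z (1 * L) (\<lambda>x. if x \<in> ?M then int_sum g \<lfloor>x i\<rfloor> else 0)"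
      if g: "bounded_fun L g" for L g
    proof -
      have "\<bar>int_sum g \<lfloor>x i\<rfloor> - int_sum g \<lfloor>y i\<rfloor>\<bar> \<le> L * l1_dist x y" if "x \<in> ?M" "y \<in> ?M" for x y
      proof -
        have xy: "x = e \<lfloor>x i\<rfloor>" "y = e \<lfloor>y i\<rfloor>"
          by (rule iffD1 [OF M], fact that)+
        have "\<bar>int_sum g \<lfloor>x i\<rfloor> - int_sum g \<lfloor>y i\<rfloor>\<bar> \<le> L * \<bar>real_of_int \<lfloor>x i\<rfloor> - of_int \<lfloor>y i\<rfloor>\<bar>"
          by (rule int_sum_lipschitz) (use g in \<open>simp add: bounded_fun_def\<close>)
        then show ?thesis
          unfolding l1 [of "\<lfloor>x i\<rfloor>" "\<lfloor>y i\<rfloor>", folded xy] .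
      qed
      then show ?thesis
        using g by (simp add: lipf_def Z bounded_fun_def e_i int_sum_0)
    qed
    show "(\<lambda>x. if x \<in> ?M then int_sum (\<lambda>n. f (e (n + 1)) - f (e n)) \<lfloor>x i\<rfloor> else 0) = f"
      if f: "lipf l1_dist ?M ?Z L f" for L f
    proof
      show "(if x \<in> ?M then int_sum (\<lambda>n. f (e (n + 1)) - f (e n)) \<lfloor>x i\<rfloor> else 0) = f x" for x
      proof (cases "x \<in> ?M")
        case True
        have "f (e 0) = 0"
          by (rule lipf_zero [OF f]) (simp add: Z)
        then have "int_sum (\<lambda>n. f (e (n + 1)) - f (e n)) \<lfloor>x i\<rfloor> = f (e \<lfloor>x i\<rfloor>)"
          by (rule int_sum_unique [of "\<lambda>n. f (e n)"])
        then show ?thesis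
          unfolding iffD1 [OF M True, symmetric] using True by simp
      next
        case False
        then show ?thesis
          using lipf_zero [OF f, of x] by simp
      qed
    qed
    show "(\<lambda>n. (if e (n + 1) \<in> ?M then int_sum g \<lfloor>e (n + 1) i\<rfloor> else 0) -
        (if e n \<in> ?M then int_sum g \<lfloor>e n i\<rfloor> else 0)) = g" for g
      by (simp add: eM e_i int_sum_Suc)
  qed simp_all
qed

text \<open>\<open>lip_box_two_ints\<close> and \<open>square_absorb\<close> lead from
  \<open>I - {i, j}\<close> to \<open>I\<close>; the induction removes two coordinates at a time and
  therefore starts at ranks zero and one.\<close>

lemma lip_lattice_square:
  fixes I :: "'k::finite set"
  shows "lip_lattice I \<sim>\<^sub>F lip_lattice I \<oplus>\<^sub>F lip_lattice I"
proof (induction "card I" arbitrary: I rule: less_induct)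
  case less
  consider "I = {}" | i where "I = {i}" | i j where "i \<in> I" "j \<in> I" "i \<noteq> j"
    by blast
  then show ?case
  proof cases
    case 1
    have "box_set (lattice_box {}) = {\<lambda>_ :: 'k. 0}"
      by (auto simp: box_set_def lattice_box_def)
    then have *: "lip_lattice {} L f \<longleftrightarrow> 0 \<le> L \<and> f = (\<lambda>_. 0)" for L and f :: "('k \<Rightarrow> real) \<Rightarrow> real"
      by (auto simp: lip_box_def lipf_def walls_def l1_dist_def fun_eq_iff)
    show ?thesis
      unfolding 1
    proof (rule free_isoI [of "\<lambda>f _. 0" "\<lambda>f _. 0" 0 0])
      show "finite_kernel (\<lambda>f :: ('k \<Rightarrow> real) \<Rightarrow> real. \<lambda>_ :: ('k \<Rightarrow> real) + ('k \<Rightarrow> real). 0)"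
        "finite_kernel (\<lambda>f :: ('k \<Rightarrow> real) + ('k \<Rightarrow> real) \<Rightarrow> real. \<lambda>_ :: 'k \<Rightarrow> real. 0)"
        by (auto simp: finite_kernel_def intro: fin_comb_zero)
      show "(\<lambda>_. 0) = f" if "(lip_lattice {} \<oplus>\<^sub>F lip_lattice {}) L f"
        for L and f :: "('k \<Rightarrow> real) + ('k \<Rightarrow> real) \<Rightarrow> real"
      proof
        show "0 = f z" for z
          using that by (cases z) (auto simp: vsum_def * fun_eq_iff)
      qed
    qed (auto simp: vsum_def * comp_def)
  next
    case 2
    show ?thesis
      unfolding 2
      by (rule free_iso_trans [OF lip_lattice_singleton free_iso_trans [OF bounded_fun_square
            vsum_cong [OF free_iso_sym [OF lip_lattice_singleton] free_iso_sym [OF lip_lattice_singleton]]]])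
  next
    case 3
    let ?J = "I - {i, j}"
    have "card ?J < card I"
      using 3 by (intro psubset_card_mono) auto
    note IH = less [OF this]
    have eqs: "(lattice_box ?J)(i := \<int>, j := \<int>) = lattice_box I"
      "(lattice_box ?J)(i := {0}, j := {0}) = lattice_box ?J"
      "(\<lambda>_. {})(i := {}, j := {}) = (\<lambda>_ :: 'k. {} :: real set)"
      using 3 by (auto simp: lattice_box_def fun_eq_iff)
    show ?thesis
      using square_absorb [OF lip_box_two_ints(1) [OF 3(3)] _ lip_box_two_ints(2) [OF 3(3)],
          of "lattice_box ?J" "\<lambda>_. {}"] IH unfolding eqs by blast
  qed
qed

section \<open>Cells of mixed lattices\<close>

text \<open>The summand \<open>V\<close> of \<open>V'\<close> swallows \<open>B\<close>.\<close>

lemma absorb_trans: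
  assumes "V \<oplus>\<^sub>F B \<sim>\<^sub>F V" "V' \<sim>\<^sub>F V \<oplus>\<^sub>F R"
  shows "V' \<oplus>\<^sub>F B \<sim>\<^sub>F V'"
proof -
  have "V' \<oplus>\<^sub>F B \<sim>\<^sub>F B \<oplus>\<^sub>F V'"
    by (rule vsum_commute)
  also have "\<dots> \<sim>\<^sub>F B \<oplus>\<^sub>F (V \<oplus>\<^sub>F R)"
    by (rule vsum_cong2 [OF assms(2)])
  also have "\<dots> \<sim>\<^sub>F (B \<oplus>\<^sub>F V) \<oplus>\<^sub>F R"
    by (rule free_iso_sym [OF vsum_assoc])
  also have "\<dots> \<sim>\<^sub>F V \<oplus>\<^sub>F R"
    by (rule vsum_cong1 [OF free_iso_trans [OF vsum_commute assms(1)]])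
  also have "\<dots> \<sim>\<^sub>F V'"
    by (rule free_iso_sym [OF assms(2)])
  finally show ?thesis .
qed

text \<open>\<open>lip_lattice I\<close> absorbs a copy of itself by
  \<open>lip_lattice_square\<close>, and each further coordinate only adds a summand to the
  absorbing space.\<close>

lemma lip_lattice_absorb:
  fixes I J :: "'k::finite set"
  shows "lip_lattice (J \<union> I) \<oplus>\<^sub>F lip_lattice I \<sim>\<^sub>F lip_lattice (J \<union> I)"
  using finite [of J]
proof (induction J rule: finite_induct)
  case empty
  show ?case
    using free_iso_sym [OF lip_lattice_square [of I]] by simp
next
  case (insert j J)
  show ?case
  proof (cases "j \<in> J \<union> I")
    case True
    then have "insert j J \<union> I = J \<union> I"
      by blast
    then show ?thesis
      using insert.IH by simp
  next
    case False
    then show ?thesis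
      using absorb_trans [OF insert.IH lip_lattice_insert [OF False]] by simp
  qed
qed

section \<open>Boxes with free real, walled real and integer coordinates\<close>

definition mixed_box :: "'k set \<Rightarrow> 'k set \<Rightarrow> 'k \<Rightarrow> real set"
  where "mixed_box U T k = (if k \<in> U then UNIV else if k \<in> T then \<int> else {0})"

definition mixed_walls :: "'k set \<Rightarrow> 'k \<Rightarrow> real set"
  where "mixed_walls S k = (if k \<in> S then \<int> else {})"

abbreviation lip_mixed :: "'k::finite set \<Rightarrow> 'k set \<Rightarrow> 'k set \<Rightarrow> real \<Rightarrow> (('k \<Rightarrow> real) \<Rightarrow> real) \<Rightarrow> bool"
  where "lip_mixed U S T \<equiv> lip_box (mixed_box (U \<union> S) T) (mixed_walls S)"

text \<open>Interpolation turns a free real coordinate into an integer coordinate in one summand and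
  a walled one in the other. Iteration over \<open>U\<close> gives one summand for each set of
  walled coordinates.\<close>

lemma lip_mixed_insert:
  assumes "i \<notin> U \<union> S \<union> T"
  shows "lip_mixed (insert i U) S T \<sim>\<^sub>F lip_mixed U S (insert i T) \<oplus>\<^sub>F lip_mixed U (insert i S) T"
proof -
  let ?D = "mixed_box (insert i U \<union> S) T" and ?W = "mixed_walls S"
  have eqs: "?D(i := UNIV) = ?D" "?W(i := {}) = ?W"
    "?D(i := \<int>) = mixed_box (U \<union> S) (insert i T)" "?W(i := \<int>) = mixed_walls (insert i S)"
    using assms by (auto simp: mixed_box_def mixed_walls_def fun_eq_iff)
  have "U \<union> insert i S = insert i U \<union> S"
    by blast
  then show ?thesis
    using lip_box_real_split [of ?D i ?W] unfolding eqs by simp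
qed

section \<open>Independence of the unit cells\<close>

definition int_dist :: "real \<Rightarrow> real"
  where "int_dist t = min (frac t) (1 - frac t)"

lemma int_dist_le_half: "int_dist t \<le> 1 / 2"
  by (simp add: int_dist_def min_def)

text \<open>Some integer lies between \<open>s\<close> and \<open>t\<close>.\<close>

lemma int_dist_add_le:
  assumes "\<lfloor>s\<rfloor> \<noteq> \<lfloor>t\<rfloor>"
  shows "int_dist s + int_dist t \<le> \<bar>s - t\<bar>"
proof -
  have le: "int_dist s + int_dist t \<le> t - s" if "\<lfloor>s\<rfloor> < \<lfloor>t\<rfloor>" for s t
  proof -
    have "real_of_int \<lfloor>s\<rfloor> + 1 \<le> of_int \<lfloor>t\<rfloor>"
      using that by linarith
    moreover have "int_dist s \<le> 1 - frac s" "int_dist t \<le> frac t"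
      by (auto simp: int_dist_def)
    ultimately show ?thesis
      unfolding frac_def by linarith
  qed
  show ?thesis
    using le [of s t] le [of t s] assms by (cases "\<lfloor>s\<rfloor> < \<lfloor>t\<rfloor>") linarith+
qed

definition cell :: "('k \<Rightarrow> real) \<Rightarrow> 'k \<Rightarrow> int"
  where "cell x k = \<lfloor>x k\<rfloor>"

text \<open>Cells are relabelled while the position inside the cell is kept. In an integer
  coordinate the fractional part is \<open>0\<close> and the label is the coordinate itself.\<close>

definition move_cell :: "(('k \<Rightarrow> int) \<Rightarrow> 'k \<Rightarrow> int) \<Rightarrow> ('k \<Rightarrow> real) \<Rightarrow> 'k \<Rightarrow> real"
  where "move_cell \<phi> x k = of_int (\<phi> (cell x) k) + frac (x k)"

text \<open>Labels of the cells meeting a box: real and integer coordinates alike contribute one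
  free integer, so only their union counts.\<close>

definition lattice_cells :: "'k set \<Rightarrow> ('k \<Rightarrow> int) set"
  where "lattice_cells I = {c. \<forall>k. k \<notin> I \<longrightarrow> c k = 0}"

lemma floor_move_cell: "\<lfloor>move_cell \<phi> x k\<rfloor> = \<phi> (cell x) k"
  using frac_lt_1 [of "x k"] by (simp add: move_cell_def floor_eq_iff)

lemma cell_move_cell: "cell (move_cell \<phi> x) = \<phi> (cell x)"
  by (simp add: fun_eq_iff cell_def [of "move_cell \<phi> x"] floor_move_cell)

lemma frac_move_cell: "frac (move_cell \<phi> x k) = frac (x k)"
  by (simp add: frac_def [of "move_cell \<phi> x k"] floor_move_cell) (simp add: move_cell_def)

lemma move_cell_move_cell:
  assumes "\<psi> (\<phi> (cell x)) = cell x"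
  shows "move_cell \<psi> (move_cell \<phi> x) = x"
proof
  show "move_cell \<psi> (move_cell \<phi> x) k = x k" for k
    unfolding move_cell_def [of \<psi>] cell_move_cell frac_move_cell assms
    by (simp add: cell_def frac_def)
qed

lemma move_cell_box_set:
  assumes "x \<in> box_set (mixed_box S T)" "\<phi> (cell x) \<in> lattice_cells (S \<union> T')"
  shows "move_cell \<phi> x \<in> box_set (mixed_box S T')"
proof -
  have "move_cell \<phi> x k \<in> mixed_box S T' k" for k
  proof (cases "k \<in> S")
    case False
    then have "x k \<in> \<int>"
      using assms(1) by (auto simp: box_set_def mixed_box_def split: if_splits dest!: spec [of _ k])
    then have "move_cell \<phi> x k = of_int (\<phi> (cell x) k)"
      by (simp add: move_cell_def)
    then show ?thesis
      using False assms(2) by (auto simp: mixed_box_def lattice_cells_def)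
  qed (simp add: mixed_box_def)
  then show ?thesis
    by (simp add: box_set_def)
qed

lemma cell_in_lattice_cells:
  assumes "x \<in> box_set (mixed_box S T)"
  shows "cell x \<in> lattice_cells (S \<union> T)"
proof -
  have "\<lfloor>x k\<rfloor> = 0" if "k \<notin> S \<union> T" for k
    using assms that by (auto simp: box_set_def mixed_box_def split: if_splits dest!: spec [of _ k])
  then show ?thesis
    by (simp add: lattice_cells_def cell_def)
qed

text \<open>For nonempty \<open>S\<close> the origin already lies on a wall, so the base point adds
  no condition and relabelling may move it.\<close>

lemma walls_mixed:
  assumes "S \<noteq> {}"
  shows "x \<in> walls (mixed_walls S) \<longleftrightarrow> (\<exists>k\<in>S. frac (x k) = 0)"
  using assms by (auto simp: walls_def mixed_walls_def split: if_splits)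

text \<open>
  This decay at the walls makes functions on different cells independent of each other: permuting
  cells does not increase the Lipschitz constant.
\<close>

lemma lipf_mixed_le_int_dist:
  fixes x :: "'k::finite \<Rightarrow> real"
  assumes f: "lipf l1_dist (box_set (mixed_box S T)) (walls (mixed_walls S)) L f"
    and x: "x \<in> box_set (mixed_box S T)" and k: "k \<in> S"
  shows "\<bar>f x\<bar> \<le> L * int_dist (x k)"
proof -
  \<comment> \<open>The comparison point lies on the wall at the integer \<open>n\<close>; the floor
    of \<open>x k\<close> and its successor then give the distance to the nearest integer.\<close>
  have *: "\<bar>f x\<bar> \<le> L * \<bar>x k - of_int n\<bar>" for n
  proof -
    let ?y = "x(k := of_int n)"
    have "?y l \<in> mixed_box S T l" for l
      using x k by (cases "l = k") (simp_all add: box_set_def mixed_box_def)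
    then have "?y \<in> box_set (mixed_box S T)"
      by (simp add: box_set_def)
    moreover have "?y \<in> walls (mixed_walls S)"
      using k by (auto simp: walls_def mixed_walls_def intro!: exI [of _ k])
    moreover have "l1_dist x ?y = \<bar>x k - of_int n\<bar>"
      using l1_dist_upd [of x k "x k" x "of_int n"] by simp
    ultimately show ?thesis
      using lipf_le [OF f x, of ?y] lipf_zero [OF f, of ?y] by simp
  qed
  have "\<bar>x k - of_int (\<lfloor>x k\<rfloor> + 1)\<bar> = 1 - frac (x k)" "\<bar>x k - of_int \<lfloor>x k\<rfloor>\<bar> = frac (x k)"
    using frac_lt_1 [of "x k"] frac_ge_0 [of "x k"] unfolding frac_def of_int_add of_int_1 by linarith+
  then show ?thesis
    using * [of "\<lfloor>x k\<rfloor>"] * [of "\<lfloor>x k\<rfloor> + 1"] by (metis int_dist_def min_def)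
qed

text \<open>Within one cell the move is a translation. For points of different cells both values are
  bounded by their decay at the walls, and the two distances to the walls together do not exceed the
  distance of the points.\<close>

lemma lipf_move_cell:
  fixes f :: "('k::finite \<Rightarrow> real) \<Rightarrow> real"
  assumes "S \<noteq> {}"
    and \<phi>: "\<And>c. c \<in> lattice_cells (S \<union> T) \<Longrightarrow> \<phi> c \<in> lattice_cells (S \<union> T')"
    and f: "lipf l1_dist (box_set (mixed_box S T')) (walls (mixed_walls S)) L f"
  shows "lipf l1_dist (box_set (mixed_box S T)) (walls (mixed_walls S)) L
    (\<lambda>x. if x \<in> box_set (mixed_box S T) then f (move_cell \<phi> x) else 0)"
proof -
  let ?M = "box_set (mixed_box S T)" and ?M' = "box_set (mixed_box S T')"
  have L: "0 \<le> L" using f by (rule lipf_nonneg)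
  have mv: "move_cell \<phi> x \<in> ?M'" if "x \<in> ?M" for x
    by (rule move_cell_box_set [where \<phi> = \<phi>, OF that \<phi> [OF cell_in_lattice_cells [OF that]]])
  have id: "\<bar>f (move_cell \<phi> x)\<bar> \<le> L * int_dist (x k)" if "x \<in> ?M" "k \<in> S" for x k
    using lipf_mixed_le_int_dist [OF f mv [OF that(1)] that(2)] by (simp add: int_dist_def frac_move_cell)
  have "\<bar>f (move_cell \<phi> x) - f (move_cell \<phi> y)\<bar> \<le> L * l1_dist x y" if xy: "x \<in> ?M" "y \<in> ?M" for x y
  proof (cases "cell x = cell y")
    case True
    have "move_cell \<phi> x k - move_cell \<phi> y k = x k - y k" for k
    proof -
      have "\<lfloor>x k\<rfloor> = \<lfloor>y k\<rfloor>"
        using fun_cong [OF True, of k] by (simp add: cell_def)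
      then show ?thesis
        by (simp add: move_cell_def True frac_def)
    qed
    then show ?thesis
      using lipf_le [OF f mv [OF xy(1)] mv [OF xy(2)]] by (simp add: l1_dist_def)
  next
    case False
    then obtain k where k: "\<lfloor>x k\<rfloor> \<noteq> \<lfloor>y k\<rfloor>"
      by (auto simp: cell_def fun_eq_iff)
    \<comment> \<open>If the cells differ in a walled coordinate, that one serves. Otherwise they
      differ by at least \<open>1\<close> in an integer coordinate, which makes room for two
      distances of at most \<open>1 / 2\<close> in any walled coordinate.\<close>
    obtain k' where k': "k' \<in> S" "int_dist (x k') + int_dist (y k') \<le> \<bar>x k - y k\<bar>"
    proof (cases "k \<in> S")
      case True
      then show ?thesis
        using that int_dist_add_le [OF k] by blast
    next
      case False
      obtain k' where k': "k' \<in> S"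
        using assms(1) by blast
      have "x k \<in> \<int>" "y k \<in> \<int>"
        using xy False by (auto simp: box_set_def mixed_box_def split: if_splits dest!: spec [of _ k])
      then obtain m n where mn: "x k = of_int m" "y k = of_int n"
        by (auto elim!: Ints_cases)
      with k have "m + 1 \<le> n \<or> n + 1 \<le> m"
        by auto
      then have "1 \<le> \<bar>x k - y k\<bar>"
        unfolding mn by linarith
      then show ?thesis
        using that [OF k'] int_dist_le_half [of "x k'"] int_dist_le_half [of "y k'"] by linarith
    qed
    have "\<bar>f (move_cell \<phi> x) - f (move_cell \<phi> y)\<bar> \<le> L * int_dist (x k') + L * int_dist (y k')"
      using id [OF xy(1) k'(1)] id [OF xy(2) k'(1)] by linarith
    also have "\<dots> = L * (int_dist (x k') + int_dist (y k'))"
      by (simp add: distrib_left)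
    also have "\<dots> \<le> L * \<bar>x k - y k\<bar>"
      by (rule mult_left_mono [OF k'(2) L])
    also have "\<dots> \<le> L * l1_dist x y"
      by (rule mult_left_mono [OF l1_dist_coord L])
    finally show ?thesis .
  qed
  moreover have "f (move_cell \<phi> x) = 0" if "x \<in> walls (mixed_walls S)" for x
    by (rule lipf_zero [OF f]) (use that in \<open>simp add: walls_mixed [OF assms(1)] frac_move_cell\<close>)
  ultimately show ?thesis
    using L by (simp add: lipf_def)
qed

text \<open>Both sets are countably infinite.\<close>

lemma lattice_cells_bij:
  fixes I J :: "'k::finite set"
  assumes "I \<noteq> {}" "J \<noteq> {}"
  obtains \<phi> where "bij_betw \<phi> (lattice_cells I) (lattice_cells J)"
proof -
  have inf: "infinite (lattice_cells I)" if "i \<in> I" for i and I :: "'k set"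
  proof (rule infinite_super)
    show "range (\<lambda>n. (\<lambda>_. 0)(i := n)) \<subseteq> lattice_cells I"
      using that by (auto simp: lattice_cells_def)
    have "inj (\<lambda>n. (\<lambda>_ :: 'k. 0 :: int)(i := n))"
      by (rule injI) (metis fun_upd_same)
    then show "infinite (range (\<lambda>n. (\<lambda>_ :: 'k. 0 :: int)(i := n)))"
      by (simp add: finite_image_iff infinite_UNIV_int)
  qed
  have "bij_betw (to_nat_on (lattice_cells I)) (lattice_cells I) UNIV"
    "bij_betw (from_nat_into (lattice_cells J)) UNIV (lattice_cells J)"
    using inf assms by (auto intro!: to_nat_on_infinite bij_betw_from_nat_into)
  then show ?thesis
    using that bij_betw_trans by blast
qed

text \<open>With every real coordinate walled, a function is a family of independent functions on
  unit cells, and any bijection between the labels transports it. The integer coordinates leave no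
  trace.\<close>

lemma lip_mixed_cells:
  fixes S T T' :: "'k::finite set"
  assumes "S \<noteq> {}"
  shows "lip_mixed {} S T \<sim>\<^sub>F lip_mixed {} S T'"
proof -
  obtain \<phi> where \<phi>: "bij_betw \<phi> (lattice_cells (S \<union> T)) (lattice_cells (S \<union> T'))"
    using lattice_cells_bij [of "S \<union> T" "S \<union> T'"] assms by blast
  define \<psi> where "\<psi> = inv_into (lattice_cells (S \<union> T)) \<phi>"
  have \<psi>: "bij_betw \<psi> (lattice_cells (S \<union> T')) (lattice_cells (S \<union> T))"
    unfolding \<psi>_def by (rule bij_betw_inv_into [OF \<phi>])
  have \<psi>\<phi>: "\<psi> (\<phi> c) = c" if "c \<in> lattice_cells (S \<union> T)" for c
    unfolding \<psi>_def by (rule bij_betw_inv_into_left [OF \<phi> that])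
  have \<phi>\<psi>: "\<phi> (\<psi> c) = c" if "c \<in> lattice_cells (S \<union> T')" for c
    unfolding \<psi>_def by (rule bij_betw_inv_into_right [OF \<phi> that])
  note m = bij_betwE [OF \<phi>, rule_format] bij_betwE [OF \<psi>, rule_format]
  let ?M = "box_set (mixed_box S T)" and ?M' = "box_set (mixed_box S T')" and ?Z = "walls (mixed_walls S)"
  have mv: "move_cell \<phi> x \<in> ?M'" "move_cell \<psi> (move_cell \<phi> x) = x" if "x \<in> ?M" for x
    using cell_in_lattice_cells [OF that] move_cell_box_set [OF that] m(1) \<psi>\<phi>
    by (auto intro: move_cell_move_cell)
  have mv': "move_cell \<psi> x \<in> ?M" "move_cell \<phi> (move_cell \<psi> x) = x" if "x \<in> ?M'" for x
    using cell_in_lattice_cells [OF that] move_cell_box_set [OF that] m(2) \<phi>\<psi>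
    by (auto intro: move_cell_move_cell)
  have "lipf l1_dist ?M ?Z \<sim>\<^sub>F lipf l1_dist ?M' ?Z"
  proof (rule free_isoI [of "\<lambda>f x. if x \<in> ?M' then f (move_cell \<psi> x) else 0"
        "\<lambda>f x. if x \<in> ?M then f (move_cell \<phi> x) else 0" 1 1])
    show "finite_kernel (\<lambda>f x. if x \<in> ?M' then f (move_cell \<psi> x) else 0)"
      "finite_kernel (\<lambda>f x. if x \<in> ?M then f (move_cell \<phi> x) else 0)"
      unfolding finite_kernel_def by (intro allI fin_comb_if fin_comb_eval fin_comb_zero)+
    show "lipf l1_dist ?M' ?Z (1 * L) (\<lambda>x. if x \<in> ?M' then f (move_cell \<psi> x) else 0)"
      if "lipf l1_dist ?M ?Z L f" for L f
      using lipf_move_cell [OF assms m(2) that] by simp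
    show "lipf l1_dist ?M ?Z (1 * L) (\<lambda>x. if x \<in> ?M then f (move_cell \<phi> x) else 0)"
      if "lipf l1_dist ?M' ?Z L f" for L f
      using lipf_move_cell [OF assms m(1) that] by simp
    show "(\<lambda>x. if x \<in> ?M then if move_cell \<phi> x \<in> ?M' then f (move_cell \<psi> (move_cell \<phi> x)) else 0 else 0) = f"
      if f: "lipf l1_dist ?M ?Z L f" for L f
      using mv lipf_zero [OF f] by (intro ext) simp
    show "(\<lambda>x. if x \<in> ?M' then if move_cell \<psi> x \<in> ?M then f (move_cell \<phi> (move_cell \<psi> x)) else 0 else 0) = f"
      if f: "lipf l1_dist ?M' ?Z L f" for L f
      using mv' lipf_zero [OF f] by (intro ext) simp
  qed simp_all
  then show ?thesis
    by (simp add: lip_box_def)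
qed

text \<open>Free coordinates are split until none is left and \<open>lip_mixed_cells\<close>
  applies. The sets vary in the induction because \<open>i\<close> joins the integer coordinates in
  one summand and \<open>S\<close> in the other.\<close>

lemma lip_mixed_change:
  fixes U S T T' :: "'k::finite set"
  assumes "S \<noteq> {}" "U \<inter> S = {}" "U \<inter> T = {}" "U \<inter> T' = {}" "S \<inter> T = {}" "S \<inter> T' = {}"
  shows "lip_mixed U S T \<sim>\<^sub>F lip_mixed U S T'"
  using finite [of U] assms
proof (induction U arbitrary: S T T' rule: finite_induct)
  case empty
  then show ?case by (intro lip_mixed_cells)
next
  case (insert i U)
  have "lip_mixed (insert i U) S T \<sim>\<^sub>F lip_mixed U S (insert i T) \<oplus>\<^sub>F lip_mixed U (insert i S) T"
    using insert by (intro lip_mixed_insert) auto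
  also have "\<dots> \<sim>\<^sub>F lip_mixed U S (insert i T') \<oplus>\<^sub>F lip_mixed U (insert i S) T'"
    using insert.prems insert.hyps by (intro vsum_cong insert.IH) auto
  also have "\<dots> \<sim>\<^sub>F lip_mixed (insert i U) S T'"
    using insert by (intro free_iso_sym [OF lip_mixed_insert]) auto
  finally show ?case .
qed

section \<open>Exchange and absorption of lattice summands\<close>

lemma lip_mixed_lattice: "lip_mixed {} {} T = lip_lattice T" for T :: "'k::finite set"
proof -
  have "mixed_box {} T = lattice_box T" "mixed_walls {} = (\<lambda>_ :: 'k. {})"
    by (auto simp: mixed_box_def lattice_box_def mixed_walls_def fun_eq_iff)
  then show ?thesis
    by simp
qed

text \<open>Isomorphisms do not cancel, so the lattice that distinguishes \<open>T\<close> from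
  \<open>T'\<close> is supplied on the opposite side. Walled summands are indifferent to
  \<open>T\<close> by \<open>lip_mixed_change\<close>; once no real coordinate is left, the claim is
  commutativity.\<close>

lemma lip_mixed_exchange:
  fixes U T T' :: "'k::finite set"
  assumes "U \<inter> T = {}" "U \<inter> T' = {}"
  shows "lip_mixed U {} T \<oplus>\<^sub>F lip_lattice (U \<union> T') \<sim>\<^sub>F lip_mixed U {} T' \<oplus>\<^sub>F lip_lattice (U \<union> T)"
  using finite [of U] assms
proof (induction U arbitrary: T T' rule: finite_induct)
  case empty
  show ?case
    unfolding lip_mixed_lattice by (simp add: vsum_commute)
next
  case (insert i U)
  have un: "insert i U \<union> X = U \<union> insert i X" for X
    by blast
  have ins: "lip_mixed (insert i U) {} X \<sim>\<^sub>F lip_mixed U {i} X \<oplus>\<^sub>F lip_mixed U {} (insert i X)"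
    if "insert i U \<inter> X = {}" for X
    by (rule free_iso_trans [OF lip_mixed_insert vsum_commute]) (use that insert.hyps in auto)
  have "lip_mixed (insert i U) {} T \<oplus>\<^sub>F lip_lattice (insert i U \<union> T') \<sim>\<^sub>F
      (lip_mixed U {i} T \<oplus>\<^sub>F lip_mixed U {} (insert i T)) \<oplus>\<^sub>F lip_lattice (insert i U \<union> T')"
    by (rule vsum_cong1 [OF ins [OF insert.prems(1)]])
  also have "\<dots> \<sim>\<^sub>F lip_mixed U {i} T \<oplus>\<^sub>F (lip_mixed U {} (insert i T) \<oplus>\<^sub>F lip_lattice (insert i U \<union> T'))"
    by (rule vsum_assoc)
  also have "\<dots> \<sim>\<^sub>F lip_mixed U {i} T' \<oplus>\<^sub>F (lip_mixed U {} (insert i T') \<oplus>\<^sub>F lip_lattice (insert i U \<union> T))"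
    unfolding un
    by (rule vsum_cong [OF lip_mixed_change insert.IH]) (use insert.prems insert.hyps in auto)
  also have "\<dots> \<sim>\<^sub>F (lip_mixed U {i} T' \<oplus>\<^sub>F lip_mixed U {} (insert i T')) \<oplus>\<^sub>F lip_lattice (insert i U \<union> T)"
    by (rule free_iso_sym [OF vsum_assoc])
  also have "\<dots> \<sim>\<^sub>F lip_mixed (insert i U) {} T' \<oplus>\<^sub>F lip_lattice (insert i U \<union> T)"
    by (rule vsum_cong1 [OF free_iso_sym [OF ins [OF insert.prems(2)]]])
  finally show ?case .
qed

text \<open>Discretising the real coordinates one by one exhibits
  \<open>lip_lattice (U \<union> T)\<close> as a summand, which does the absorbing.\<close>

lemma lip_mixed_absorb:
  fixes U T :: "'k::finite set"
  assumes "U \<inter> T = {}" "lip_lattice (U \<union> T) \<oplus>\<^sub>F B \<sim>\<^sub>F lip_lattice (U \<union> T)"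
  shows "lip_mixed U {} T \<oplus>\<^sub>F B \<sim>\<^sub>F lip_mixed U {} T"
  using finite [of U] assms
proof (induction U arbitrary: T rule: finite_induct)
  case empty
  then show ?case
    unfolding lip_mixed_lattice by simp
next
  case (insert i U)
  have "lip_mixed U {} (insert i T) \<oplus>\<^sub>F B \<sim>\<^sub>F lip_mixed U {} (insert i T)"
    using insert.prems insert.hyps by (intro insert.IH) auto
  then show ?case
    by (rule absorb_trans [OF _ lip_mixed_insert]) (use insert.prems insert.hyps in auto)
qed

text \<open>A copy of \<open>lip_lattice U\<close> is added by absorption;
  \<open>lip_mixed_exchange\<close> with empty \<open>T'\<close> then trades the integer coordinates
  for the larger lattice.\<close>

lemma lip_mixed_iso:
  fixes U T :: "'k::finite set"
  assumes "U \<inter> T = {}"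
  shows "lip_mixed U {} T \<sim>\<^sub>F lip_mixed U {} {} \<oplus>\<^sub>F lip_lattice (U \<union> T)"
proof -
  have "lip_lattice (U \<union> T) \<oplus>\<^sub>F lip_lattice U \<sim>\<^sub>F lip_lattice (U \<union> T)"
    using lip_lattice_absorb [of T U] by (simp add: Un_commute)
  from free_iso_sym [OF lip_mixed_absorb [OF assms this]]
  have "lip_mixed U {} T \<sim>\<^sub>F lip_mixed U {} T \<oplus>\<^sub>F lip_lattice (U \<union> {})"
    by simp
  also have "\<dots> \<sim>\<^sub>F lip_mixed U {} {} \<oplus>\<^sub>F lip_lattice (U \<union> T)"
    using assms by (intro lip_mixed_exchange) auto
  finally show ?thesis .
qed

section \<open>Passing to Lipschitz-free spaces\<close>

lemma lipf_mono:
  assumes "lipf dist M Z a f" "a \<le> b"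
  shows "lipf dist M Z b f"
proof -
  have "\<bar>f x - f y\<bar> \<le> b * dist x y" if "x \<in> M" "y \<in> M" for x y
    using lipf_le [OF assms(1) that] mult_right_mono [OF assms(2) zero_le_dist [of x y]] by linarith
  then show ?thesis
    using assms by (simp add: lipf_def)
qed

lemma lipf_apply_lip0: "lipf dist UNIV {0} (norm g) (apply_lip0 g)"
proof (transfer)
  fix g :: "'a \<Rightarrow> real"
  assume g: "g 0 = 0 \<and> (\<exists>L. L-lipschitz_on UNIV g)"
  then have "(lipschitz_const g)-lipschitz_on UNIV g"
    by (auto intro: lipschitz_on_lipschitz_const)
  then show "lipf dist UNIV {0} (lipschitz_const g) g"
    using g by (auto simp: lipf_def lipschitz_on_def dist_real_def)
qed

lemma
  fixes f :: "'a :: {metric_space, zero} \<Rightarrow> real"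
  assumes "lipf dist UNIV {0} L f"
  shows apply_Lip0: "apply_lip0 (Lip0 f) = f" and norm_Lip0_le: "norm (Lip0 f) \<le> L"
proof -
  have f: "L-lipschitz_on UNIV f"
    using assms by (auto simp: lipf_def lipschitz_on_def dist_real_def)
  then show *: "apply_lip0 (Lip0 f) = f"
    using assms by (intro Lip0_inverse) (auto simp: lipf_def)
  show "norm (Lip0 f) \<le> L"
    unfolding norm_lip0.rep_eq * by (rule lipschitz_const_le [OF f])
qed

lemma lip0_eqI: "(\<And>x. apply_lip0 f x = apply_lip0 g x) \<Longrightarrow> f = g"
  by (metis apply_lip0_inject ext)

lemma lip_free_eqI:
  assumes "\<And>g. blinfun_apply (functional_of \<mu>) g = blinfun_apply (functional_of \<nu>) g"
  shows "\<mu> = \<nu>"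
  using assms by (metis functional_of_inject blinfun_eqI)

section \<open>Adjoints of finite kernels on free spaces\<close>

definition lipf_bounded :: "real \<Rightarrow> (('a :: {metric_space, zero} \<Rightarrow> real) \<Rightarrow> 'b :: {metric_space, zero} \<Rightarrow> real) \<Rightarrow> bool"
  where "lipf_bounded C T \<longleftrightarrow> finite_kernel T \<and> (\<forall>L f. lipf dist UNIV {0} L f \<longrightarrow> lipf dist UNIV {0} (C * L) (T f))"

lemma lipf_boundedD: "lipf_bounded C T \<Longrightarrow> lipf dist UNIV {0} L f \<Longrightarrow> lipf dist UNIV {0} (C * L) (T f)"
  by (simp add: lipf_bounded_def)

definition lip0_map :: "(('a :: {metric_space, zero} \<Rightarrow> real) \<Rightarrow> 'b :: {metric_space, zero} \<Rightarrow> real) \<Rightarrow> 'a lip0 \<Rightarrow> 'b lip0"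
  where "lip0_map T g = Lip0 (T (apply_lip0 g))"

lemma apply_lip0_map:
  assumes "lipf_bounded C T"
  shows "apply_lip0 (lip0_map T g) = T (apply_lip0 g)"
  unfolding lip0_map_def by (rule apply_Lip0 [OF lipf_boundedD [OF assms lipf_apply_lip0]])

lemma bounded_linear_lip0_map:
  assumes T: "lipf_bounded C T"
  shows "bounded_linear (lip0_map T)"
proof (rule bounded_linear_intro [where K = C])
  have k: "finite_kernel T"
    using T by (simp add: lipf_bounded_def)
  show "lip0_map T (f + g) = lip0_map T f + lip0_map T g" for f g
    using finite_kernel_linear [OF k, of 1 "apply_lip0 f" 1 "apply_lip0 g"]
    by (intro lip0_eqI) (simp add: apply_lip0_map [OF T] plus_lip0.rep_eq)
  show "lip0_map T (r *\<^sub>R f) = r *\<^sub>R lip0_map T f" for r f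
    using finite_kernel_linear [OF k, of r "apply_lip0 f" 0 "apply_lip0 f"]
    by (intro lip0_eqI) (simp add: apply_lip0_map [OF T] scaleR_lip0.rep_eq)
  show "norm (lip0_map T f) \<le> norm f * C" for f
    using norm_Lip0_le [OF lipf_boundedD [OF T lipf_apply_lip0]] by (simp add: lip0_map_def mult.commute)
qed

lemma fin_comb_in_span:
  fixes \<phi> :: "('a :: {metric_space, zero} \<Rightarrow> real) \<Rightarrow> real"
  assumes "fin_comb \<phi>"
  shows "\<exists>\<nu>\<in>span (range lip_delta). \<forall>g. blinfun_apply \<nu> g = \<phi> (apply_lip0 g)"
  using assms
proof induction
  case fin_comb_zero
  show ?case by (intro bexI [of _ 0] span_zero) simp
next
  case (fin_comb_eval x)
  show ?case by (intro bexI [of _ "lip_delta x"] span_base) (auto simp: lip_delta.rep_eq)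
next
  case (fin_comb_add \<phi> \<psi>)
  then obtain \<mu> \<nu> where "\<mu> \<in> span (range lip_delta)" "\<And>g. blinfun_apply \<mu> g = \<phi> (apply_lip0 g)"
    "\<nu> \<in> span (range lip_delta)" "\<And>g. blinfun_apply \<nu> g = \<psi> (apply_lip0 g)"
    by blast
  then show ?case
    by (intro bexI [of _ "\<mu> + \<nu>"] span_add) (auto simp: blinfun.add_left)
next
  case (fin_comb_cmult \<phi> c)
  then obtain \<mu> where "\<mu> \<in> span (range lip_delta)" "\<And>g. blinfun_apply \<mu> g = \<phi> (apply_lip0 g)"
    by blast
  then show ?case
    by (intro bexI [of _ "c *\<^sub>R \<mu>"] span_scale) (auto simp: blinfun.scaleR_left)
qed

text \<open>The adjoint of \<open>lip0_map T\<close>, restricted to the free space and hence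
  contravariant. That its values stay in a free space is shown next.\<close>

definition free_map :: "(('a :: {metric_space, zero} \<Rightarrow> real) \<Rightarrow> 'b :: {metric_space, zero} \<Rightarrow> real) \<Rightarrow> 'b lip_free \<Rightarrow> 'a lip_free"
  where "free_map T \<mu> = Lip_free (functional_of \<mu> o\<^sub>L Blinfun (lip0_map T))"

text \<open>Because the kernel is finite, the adjoint sends each delta into the span of the deltas;
  by linearity and continuity it maps closed span into closed span.\<close>

lemma functional_of_free_map:
  fixes T :: "('a :: {metric_space, zero} \<Rightarrow> real) \<Rightarrow> 'b :: {metric_space, zero} \<Rightarrow> real"
  assumes T: "lipf_bounded C T"
  shows "functional_of (free_map T \<mu>) = functional_of \<mu> o\<^sub>L Blinfun (lip0_map T)"
  unfolding free_map_def
proof (rule Lip_free_inverse)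
  let ?B = "Blinfun (lip0_map T)"
  let ?\<Phi> = "\<lambda>\<nu> :: 'b lip0 \<Rightarrow>\<^sub>L real. \<nu> o\<^sub>L ?B"
  have lin: "bounded_linear ?\<Phi>"
    by (rule bounded_bilinear.bounded_linear_left [OF bounded_bilinear_blinfun_compose])
  have "?\<Phi> (lip_delta x) \<in> span (range lip_delta)" for x
  proof -
    have "fin_comb (\<lambda>f. T f x)"
      using T by (simp add: lipf_bounded_def finite_kernel_def)
    then obtain \<nu> where \<nu>: "\<nu> \<in> span (range lip_delta)" "\<And>g. blinfun_apply \<nu> g = T (apply_lip0 g) x"
      using fin_comb_in_span [of "\<lambda>f. T f x"] by blast
    have "?\<Phi> (lip_delta x) = \<nu>"
      by (rule blinfun_eqI)
        (simp add: \<nu>(2) lip_delta.rep_eq bounded_linear_Blinfun_apply [OF bounded_linear_lip0_map [OF T]]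
          apply_lip0_map [OF T])
    with \<nu>(1) show ?thesis by simp
  qed
  then have "span (?\<Phi> ` range lip_delta) \<subseteq> span (range lip_delta)"
    by (intro span_minimal subspace_span) auto
  then have "?\<Phi> ` span (range lip_delta) \<subseteq> span (range lip_delta)"
    by (simp only: linear_span_image [OF bounded_linear.linear [OF lin]])
  from order_trans [OF closure_bounded_linear_image_subset [OF lin] closure_mono [OF this]]
  have "?\<Phi> ` closure (span (range lip_delta)) \<subseteq> closure (span (range lip_delta))" .
  from subsetD [OF this imageI [OF functional_of]]
  show "functional_of \<mu> o\<^sub>L ?B \<in> closure (span (range lip_delta))" .
qed

lemma free_map_apply:
  assumes "lipf_bounded C T"
  shows "blinfun_apply (functional_of (free_map T \<mu>)) g = blinfun_apply (functional_of \<mu>) (lip0_map T g)"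
  by (simp add: functional_of_free_map [OF assms] bounded_linear_Blinfun_apply [OF bounded_linear_lip0_map [OF assms]])

lemma bounded_linear_free_map:
  assumes T: "lipf_bounded C T"
  shows "bounded_linear (free_map T)"
proof (rule bounded_linear_intro [where K = "norm (Blinfun (lip0_map T))"])
  show "free_map T (\<mu> + \<nu>) = free_map T \<mu> + free_map T \<nu>" for \<mu> \<nu>
    by (rule lip_free_eqI) (simp add: free_map_apply [OF T] plus_lip_free.rep_eq blinfun.add_left)
  show "free_map T (r *\<^sub>R \<mu>) = r *\<^sub>R free_map T \<mu>" for r \<mu>
    by (rule lip_free_eqI) (simp add: free_map_apply [OF T] scaleR_lip_free.rep_eq blinfun.scaleR_left)
  show "norm (free_map T \<mu>) \<le> norm \<mu> * norm (Blinfun (lip0_map T))" for \<mu>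
    unfolding norm_lip_free.rep_eq functional_of_free_map [OF T] by (rule norm_blinfun_compose)
qed

text \<open>The components of \<open>S\<close> and \<open>S'\<close> give four operators whose
  relations pass to the adjoints. Adjoints reverse arrows, so \<open>T\<close> comes from
  \<open>S'\<close> and its inverse from \<open>S\<close>.\<close>

lemma lip_free_isomorphism:
  assumes "lipf dist (UNIV :: 'a :: {metric_space, zero} set) {0} \<sim>\<^sub>F lipf dist (UNIV :: 'b :: {metric_space, zero} set) {0} \<oplus>\<^sub>F
    lipf dist (UNIV :: 'c :: {metric_space, zero} set) {0}"
  shows "\<exists>T :: 'a lip_free \<Rightarrow> 'b lip_free \<times> 'c lip_free. bounded_linear T \<and> bij T \<and> bounded_linear (inv T)"
proof -
  let ?A = "lipf dist (UNIV :: 'a set) {0}"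
  let ?B = "lipf dist (UNIV :: 'b set) {0}"
  let ?C = "lipf dist (UNIV :: 'c set) {0}"
  obtain S S' D D' where iso: "iso_by ?A (?B \<oplus>\<^sub>F ?C) S S' D D'"
    using assms unfolding free_iso_def by blast
  note S = iso_byD [OF iso]
  define S1 where "S1 f = S f \<circ> Inl" for f
  define S2 where "S2 f = S f \<circ> Inr" for f
  define S1' where "S1' g = S' (case_sum g (\<lambda>_. 0))" for g
  define S2' where "S2' h = S' (case_sum (\<lambda>_. 0) h)" for h
  have bS1: "lipf_bounded D S1"
    unfolding lipf_bounded_def
  proof (intro conjI allI impI)
    show "finite_kernel S1"
      using S(1) by (simp add: finite_kernel_def S1_def)
    show "?B (D * L) (S1 f)" if f: "?A L f" for L f
      using S(5) [OF f] unfolding S1_def by (rule vsumE) (rule lipf_mono)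
  qed
  have bS2: "lipf_bounded D S2"
    unfolding lipf_bounded_def
  proof (intro conjI allI impI)
    show "finite_kernel S2"
      using S(1) by (simp add: finite_kernel_def S2_def)
    show "?C (D * L) (S2 f)" if f: "?A L f" for L f
      using S(5) [OF f] unfolding S2_def by (rule vsumE) (rule lipf_mono)
  qed
  have z: "lipf dist UNIV {0} 0 (\<lambda>_ :: 'x :: {metric_space, zero}. 0)"
    by (simp add: lipf_def)
  have vs1: "(?B \<oplus>\<^sub>F ?C) L (case_sum g (\<lambda>_. 0))" if g: "?B L g" for L g
    using g lipf_nonneg [OF g] z by (intro vsumI [of _ L _ _ 0]) (simp_all add: case_sum_comp)
  have vs2: "(?B \<oplus>\<^sub>F ?C) L (case_sum (\<lambda>_. 0) g)" if g: "?C L g" for L g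
    using g lipf_nonneg [OF g] z by (intro vsumI [of _ 0 _ _ L]) (simp_all add: case_sum_comp)
  have bS1': "lipf_bounded D' S1'"
    unfolding lipf_bounded_def
  proof (intro conjI allI impI)
    have "finite_kernel (\<lambda>g :: 'b \<Rightarrow> real. \<lambda>_ :: 'c. 0)" "finite_kernel (\<lambda>g :: 'b \<Rightarrow> real. g)"
      unfolding finite_kernel_def by (auto intro: fin_comb_zero fin_comb_eval)
    then show "finite_kernel S1'"
      unfolding S1'_def by (intro finite_kernel_comp [OF S(2) finite_kernel_case_sum])
    show "?A (D' * L) (S1' g)" if "?B L g" for L g
      unfolding S1'_def by (rule S(6) [OF vs1 [OF that]])
  qed
  have bS2': "lipf_bounded D' S2'"
    unfolding lipf_bounded_def
  proof (intro conjI allI impI)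
    have "finite_kernel (\<lambda>g :: 'c \<Rightarrow> real. \<lambda>_ :: 'b. 0)" "finite_kernel (\<lambda>g :: 'c \<Rightarrow> real. g)"
      unfolding finite_kernel_def by (auto intro: fin_comb_zero fin_comb_eval)
    then show "finite_kernel S2'"
      unfolding S2'_def by (intro finite_kernel_comp [OF S(2) finite_kernel_case_sum])
    show "?A (D' * L) (S2' g)" if "?C L g" for L g
      unfolding S2'_def by (rule S(6) [OF vs2 [OF that]])
  qed
  note map_apply = apply_lip0_map [OF bS1] apply_lip0_map [OF bS2] apply_lip0_map [OF bS1'] apply_lip0_map [OF bS2']
  have 11: "lip0_map S1 (lip0_map S1' g) = g" and 21: "lip0_map S2 (lip0_map S1' g) = 0" for g
    using S(8) [OF vs1 [OF lipf_apply_lip0 [of g]]]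
    by (auto intro!: lip0_eqI simp: map_apply S1_def S2_def S1'_def zero_lip0.rep_eq)
  have 12: "lip0_map S1 (lip0_map S2' g) = 0" and 22: "lip0_map S2 (lip0_map S2' g) = g" for g
    using S(8) [OF vs2 [OF lipf_apply_lip0 [of g]]]
    by (auto intro!: lip0_eqI simp: map_apply S1_def S2_def S2'_def zero_lip0.rep_eq)
  \<comment> \<open>The two halves of \<open>S f\<close>, padded with zero, add up to
    \<open>S f\<close>, and \<open>S'\<close> is linear and inverts \<open>S\<close>.\<close>
  have id: "lip0_map S1' (lip0_map S1 f) + lip0_map S2' (lip0_map S2 f) = f" for f
  proof (rule lip0_eqI)
    let ?f = "apply_lip0 f"
    have "(\<lambda>x. 1 * case_sum (S ?f \<circ> Inl) (\<lambda>_. 0) x + 1 * case_sum (\<lambda>_. 0) (S ?f \<circ> Inr) x) = S ?f"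
      by (rule ext) (auto split: sum.split)
    then have "(\<lambda>x. S1' (S1 ?f) x + S2' (S2 ?f) x) = S' (S ?f)"
      using finite_kernel_linear [OF S(2), of 1 "case_sum (S ?f \<circ> Inl) (\<lambda>_. 0)" 1 "case_sum (\<lambda>_. 0) (S ?f \<circ> Inr)"]
      by (simp add: S1_def S2_def S1'_def S2'_def)
    then show "apply_lip0 (lip0_map S1' (lip0_map S1 f) + lip0_map S2' (lip0_map S2 f)) x = ?f x" for x
      using S(7) [OF lipf_apply_lip0 [of f]] by (simp add: plus_lip0.rep_eq map_apply fun_eq_iff)
  qed
  define T where "T \<mu> = (free_map S1' \<mu>, free_map S2' \<mu>)" for \<mu>
  define R where "R p = free_map S1 (fst p) + free_map S2 (snd p)" for p
  note free_apply = free_map_apply [OF bS1] free_map_apply [OF bS2] free_map_apply [OF bS1'] free_map_apply [OF bS2']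
  have RT: "R (T \<mu>) = \<mu>" for \<mu>
    by (rule lip_free_eqI)
      (simp add: R_def T_def plus_lip_free.rep_eq blinfun.add_left free_apply id flip: blinfun.add_right)
  have TR: "T (R p) = p" for p
  proof -
    have "free_map S1' (R p) = fst p"
      by (rule lip_free_eqI)
        (simp add: R_def plus_lip_free.rep_eq blinfun.add_left free_apply 11 21)
    moreover have "free_map S2' (R p) = snd p"
      by (rule lip_free_eqI)
        (simp add: R_def plus_lip_free.rep_eq blinfun.add_left free_apply 12 22)
    ultimately show ?thesis
      by (simp add: T_def)
  qed
  have "bij T"
    by (rule o_bij [of R]) (auto simp: fun_eq_iff RT TR)
  moreover have "inv T = R"
    by (rule inv_equality) (auto simp: RT TR)
  moreover have "bounded_linear T"
    unfolding T_def
    by (intro bounded_linear_Pair bounded_linear_free_map [OF bS1'] bounded_linear_free_map [OF bS2'])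
  moreover have "bounded_linear R"
    unfolding R_def
    by (intro bounded_linear_add bounded_linear_compose [OF bounded_linear_free_map [OF bS1] bounded_linear_fst]
        bounded_linear_compose [OF bounded_linear_free_map [OF bS2] bounded_linear_snd])
  ultimately show ?thesis
    by auto
qed

section \<open>The three concrete spaces in coordinates\<close>

lemma
  fixes x y :: "'k::finite \<Rightarrow> real"
  shows dist_le_l1_dist: "dist (\<chi> k. x k) (\<chi> k. y k) \<le> l1_dist x y"
    and l1_dist_le_dist: "l1_dist x y \<le> CARD('k) * dist (\<chi> k. x k) (\<chi> k. y k)"
proof -
  let ?v = "(\<chi> k. x k) - (\<chi> k. y k) :: real ^ 'k"
  have l1: "l1_dist x y = (\<Sum>k\<in>UNIV. \<bar>?v $ k\<bar>)"
    by (simp add: l1_dist_def)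
  show "dist (\<chi> k. x k) (\<chi> k. y k) \<le> l1_dist x y"
    unfolding dist_norm l1 by (rule norm_le_l1_cart)
  show "l1_dist x y \<le> CARD('k) * dist (\<chi> k. x k) (\<chi> k. y k)"
    unfolding dist_norm l1 by (rule sum_bounded_above) (rule component_le_norm_cart)
qed

text \<open>An embedding that is isometric for the Euclidean distance is bi-Lipschitz for
  \<open>l1_dist\<close>. With no walls the zero set is the base point alone.\<close>

lemma lipf_embed:
  fixes emb :: "'a :: {metric_space, zero} \<Rightarrow> 'k::finite \<Rightarrow> real"
  assumes dist: "\<And>p q. dist p q = dist ((\<chi> k. emb p k) :: real ^ 'k) (\<chi> k. emb q k)"
    and zero: "emb 0 = (\<lambda>_. 0)" and range: "range emb = box_set D"
  shows "lipf dist (UNIV :: 'a set) {0} \<sim>\<^sub>F lip_box D (\<lambda>_. {})"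
  unfolding lip_box_def
proof (rule lipf_biLipschitz [where g = emb and h = "inv emb" and C = "CARD('k)" and D = 1])
  have inj: "inj emb"
  proof (rule injI)
    fix p q assume "emb p = emb q"
    then have "dist p q = 0"
      unfolding dist by simp
    then show "p = q" by simp
  qed
  show "emb p \<in> box_set D" for p
    using range by blast
  show "inv emb (emb p) = p" for p
    using inj by simp
  show emb_inv: "emb (inv emb x) = x" if "x \<in> box_set D" for x
    using that range by (simp add: f_inv_into_f)
  show "p \<in> {0} \<longleftrightarrow> emb p \<in> walls (\<lambda>_. {})" for p
    using inj_eq [OF inj, of p 0] by (simp add: walls_def zero)
  show "l1_dist (emb p) (emb q) \<le> CARD('k) * dist p q" for p q
    unfolding dist by (rule l1_dist_le_dist)
  show "dist (inv emb x) (inv emb y) \<le> 1 * l1_dist x y" if "x \<in> box_set D" "y \<in> box_set D" for x y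
    unfolding dist emb_inv [OF that(1)] emb_inv [OF that(2)] using dist_le_l1_dist by simp
qed simp_all

lemma lipf_real_int:
  "lipf dist (UNIV :: ((real ^ 'n) \<times> (int ^ 'm)) set) {0} \<sim>\<^sub>F
    lip_mixed (range Inl :: ('n + 'm) set) {} (range Inr)"
proof -
  define emb :: "(real ^ 'n) \<times> (int ^ 'm) \<Rightarrow> 'n + 'm \<Rightarrow> real"
    where "emb p k = (case k of Inl i \<Rightarrow> fst p $ i | Inr j \<Rightarrow> real_of_int (snd p $ j))" for p k
  have "lipf dist (UNIV :: ((real ^ 'n) \<times> (int ^ 'm)) set) {0} \<sim>\<^sub>F
      lip_box (mixed_box (range Inl) (range Inr)) (\<lambda>_ :: 'n + 'm. {})"
  proof (rule lipf_embed [where emb = emb])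
    show "dist p q = dist (\<chi> k. emb p k) (\<chi> k. emb q k)" for p q
      unfolding emb_def by (rule dist_real_int_eq)
    show "emb 0 = (\<lambda>_. 0)"
      by (auto simp: emb_def fun_eq_iff split: sum.split)
    show "range emb = box_set (mixed_box (range Inl) (range Inr))"
    proof (intro equalityI subsetI)
      fix x assume "x \<in> range emb"
      then show "x \<in> box_set (mixed_box (range Inl) (range Inr))"
        by (auto simp: box_set_def mixed_box_def emb_def split: sum.split)
    next
      fix x :: "'n + 'm \<Rightarrow> real" assume x: "x \<in> box_set (mixed_box (range Inl) (range Inr))"
      have "x (Inr j) \<in> \<int>" for j
        using x by (auto simp: box_set_def mixed_box_def split: if_splits dest!: spec [of _ "Inr j"])
      then have fl: "of_int \<lfloor>x (Inr j)\<rfloor> = x (Inr j)" for j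
        by (metis Ints_cases floor_of_int)
      have "x k = emb ((\<chi> i. x (Inl i)), (\<chi> j. \<lfloor>x (Inr j)\<rfloor>)) k" for k
        by (cases k) (simp_all only: emb_def fst_conv snd_conv vec_lambda_beta sum.case fl)
      then have "x = emb ((\<chi> i. x (Inl i)), (\<chi> j. \<lfloor>x (Inr j)\<rfloor>))"
        by (rule ext)
      then show "x \<in> range emb" by blast
    qed
  qed
  moreover have "mixed_walls {} = (\<lambda>_ :: 'n + 'm. {})"
    by (simp add: mixed_walls_def fun_eq_iff)
  ultimately show ?thesis
    by simp
qed

text \<open>The index type is enlarged by coordinates frozen at \<open>0\<close>, since
  \<open>lip_mixed_iso\<close> compares spaces over one index type.\<close>

lemma lipf_real:
  "lipf dist (UNIV :: (real ^ 'n) set) {0} \<sim>\<^sub>F lip_mixed (range Inl :: ('n + 'm::finite) set) {} {}"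
proof -
  define emb :: "real ^ 'n \<Rightarrow> 'n + 'm \<Rightarrow> real"
    where "emb v k = (case k of Inl i \<Rightarrow> v $ i | Inr j \<Rightarrow> 0)" for v k
  have "lipf dist (UNIV :: (real ^ 'n) set) {0} \<sim>\<^sub>F lip_box (mixed_box (range Inl) {}) (\<lambda>_ :: 'n + 'm. {})"
  proof (rule lipf_embed [where emb = emb])
    show "dist v w = dist (\<chi> k. emb v k) (\<chi> k. emb w k)" for v w
    proof -
      \<comment> \<open>The distance formula is inherited from the mixed product by taking the
        integer part to be \<open>0\<close>.\<close>
      have "(case k of Inl i \<Rightarrow> fst (u, 0 :: int ^ 'm) $ i | Inr j \<Rightarrow> real_of_int (snd (u, 0 :: int ^ 'm) $ j)) = emb u k"
        for u k
        by (simp add: emb_def split: sum.split)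
      then show ?thesis
        using dist_real_int_eq [of "(v, 0 :: int ^ 'm)" "(w, 0)"] by (simp only: dist_Pair_Pair) simp
    qed
    show "emb 0 = (\<lambda>_. 0)"
      by (auto simp: emb_def fun_eq_iff split: sum.split)
    show "range emb = box_set (mixed_box (range Inl) {})"
    proof (intro equalityI subsetI)
      fix x assume "x \<in> range emb"
      then show "x \<in> box_set (mixed_box (range Inl) {})"
        by (auto simp: box_set_def mixed_box_def emb_def split: sum.split)
    next
      fix x :: "'n + 'm \<Rightarrow> real" assume x: "x \<in> box_set (mixed_box (range Inl) {})"
      have "x (Inr j) = 0" for j
        using x by (auto simp: box_set_def mixed_box_def split: if_splits dest!: spec [of _ "Inr j"])
      then have "x = emb (\<chi> i. x (Inl i))"
        by (auto simp: emb_def fun_eq_iff split: sum.split)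
      then show "x \<in> range emb" by blast
    qed
  qed
  moreover have "mixed_walls {} = (\<lambda>_ :: 'n + 'm. {})"
    by (simp add: mixed_walls_def fun_eq_iff)
  ultimately show ?thesis
    by simp
qed

lemma lipf_int: "lipf dist (UNIV :: (int ^ 'k) set) {0} \<sim>\<^sub>F lip_lattice (UNIV :: 'k set)"
proof (rule lipf_embed [where emb = "\<lambda>x k. real_of_int (x $ k)"])
  show "dist p q = dist (\<chi> k. real_of_int (p $ k)) (\<chi> k. real_of_int (q $ k))" for p q :: "int ^ 'k"
    by (rule dist_int_vec_eq)
  show "range (\<lambda>x k. real_of_int (x $ k)) = box_set (lattice_box (UNIV :: 'k set))"
  proof (intro equalityI subsetI)
    fix x :: "'k \<Rightarrow> real" assume "x \<in> box_set (lattice_box UNIV)"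
    then have "x k \<in> \<int>" for k
      by (simp add: box_set_def lattice_box_def)
    then have fl: "of_int \<lfloor>x k\<rfloor> = x k" for k
      by (metis Ints_cases floor_of_int)
    have "x = (\<lambda>k. real_of_int ((\<chi> k. \<lfloor>x k\<rfloor>) $ k))"
      by (simp only: vec_lambda_beta fl)
    then show "x \<in> range (\<lambda>x k. real_of_int (x $ k))"
      by blast
  qed (auto simp: box_set_def lattice_box_def)
qed simp

theorem proposition3p14:
  shows "\<exists>T :: ((real ^ 'n) \<times> (int ^ 'm)) lip_free
                \<Rightarrow> (real ^ 'n) lip_free \<times> (int ^ ('n + 'm)) lip_free.
           bounded_linear T \<and> bij T \<and> bounded_linear (inv T)"
proof (rule lip_free_isomorphism)
  let ?U = "range Inl :: ('n + 'm) set" and ?T = "range Inr :: ('n + 'm) set"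
  have UT: "?U \<union> ?T = UNIV"
    by (metis UNIV_sum)
  have "lipf dist (UNIV :: ((real ^ 'n) \<times> (int ^ 'm)) set) {0} \<sim>\<^sub>F lip_mixed ?U {} ?T"
    by (rule lipf_real_int)
  also have "\<dots> \<sim>\<^sub>F lip_mixed ?U {} {} \<oplus>\<^sub>F lip_lattice (?U \<union> ?T)"
    by (rule lip_mixed_iso) auto
  also have "\<dots> \<sim>\<^sub>F lipf dist (UNIV :: (real ^ 'n) set) {0} \<oplus>\<^sub>F lipf dist (UNIV :: (int ^ ('n + 'm)) set) {0}"
    unfolding UT by (rule vsum_cong [OF free_iso_sym [OF lipf_real] free_iso_sym [OF lipf_int]])
  finally show "lipf dist (UNIV :: ((real ^ 'n) \<times> (int ^ 'm)) set) {0} \<sim>\<^sub>F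
      lipf dist (UNIV :: (real ^ 'n) set) {0} \<oplus>\<^sub>F lipf dist (UNIV :: (int ^ ('n + 'm)) set) {0}" .
qed

end
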